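(* Let $D=(V,E)$ be a finite digraph and $k\ge1$ an integer. For each $v\in V$ let $S(v)$ be a set of size $k(d^+_D(v)+1)$, where $d^+_D(v)$ is the outdegree of $v$ in $D$. If $D$ contains no odd directed (simple) cycle, then there are subsets $C(v)\subseteq S(v)$ with $|C(v)|=k$ for all $v\in V$ and $C(u)\cap C(v)=\emptyset$ for every two adjacent vertices $u,v\in V$. Moreover, there is an algorithm running in time polynomial in $|V|$ and $k$ which finds such subsets $C(v)$.
   Context: Two vertices are adjacent in $D$ if there is an arc between them in either direction. *)

theory Defs
  imports "Graph_Theory.Graph_Theory"
begin

section \<open>Digraphs and choices of colours\<close>

text \<open>A finite digraph D = (V, E) with E a set of ordered pairs is a
  \<^locale>\<open>pair_fin_digraph\<close>. Antiparallel arcs are allowed. Loops are allowed as well, but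
  a loop is a cycle of length 1 for \<^const>\<open>pre_digraph.cycle\<close>, hence an odd one; a pair of
  antiparallel arcs is a cycle of length 2.\<close>

definition has_odd_dicycle :: "('a, 'b) pre_digraph \<Rightarrow> bool" where
  "has_odd_dicycle G \<longleftrightarrow> (\<exists>p. pre_digraph.cycle G p \<and> odd (length p))"

definition adjacent :: "('a, 'b) pre_digraph \<Rightarrow> 'a \<Rightarrow> 'a \<Rightarrow> bool" where
  "adjacent G u v \<longleftrightarrow> u \<rightarrow>\<^bsub>G\<^esub> v \<or> v \<rightarrow>\<^bsub>G\<^esub> u"

definition colour_choice ::
    "('a, 'b) pre_digraph \<Rightarrow> nat \<Rightarrow> ('a \<Rightarrow> 'c set) \<Rightarrow> ('a \<Rightarrow> 'c set) \<Rightarrow> bool" where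
  "colour_choice G k S C \<longleftrightarrow>
     (\<forall>v \<in> verts G. C v \<subseteq> S v \<and> card (C v) = k) \<and>
     (\<forall>u \<in> verts G. \<forall>v \<in> verts G. u \<noteq> v \<and> adjacent G u v \<longrightarrow> C u \<inter> C v = {})"

section \<open>Algorithms\<close>

text \<open>Algorithms are programs for a random access machine, written as structured programs.
  The memory consists of arrays of natural numbers: a cell is addressed by an array name and a
  list of indices, and a scalar variable is an array accessed with the empty list of indices.

  The only arithmetic operations are addition and truncated subtraction. There is deliberately
  no multiplication: the bit length of the numbers that occur grows by at most a constant
  (depending on the program) in each step, so unit cost for assignments and tests is
  polynomially related to the running time of a Turing machine. Expressions are part of the
  fixed program, so their evaluation takes a bounded number of elementary operations.\<close>

type_synonym memory = "string \<Rightarrow> nat list \<Rightarrow> nat"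

datatype aexp = Num nat | Cell string "aexp list" | Plus aexp aexp | Minus aexp aexp

datatype bexp = Less aexp aexp | Equal aexp aexp | Neg bexp | Conj bexp bexp

datatype com =
    Skip
  | Assign string "aexp list" aexp
  | Seq com com
  | If bexp com com
  | While bexp com

fun aval :: "aexp \<Rightarrow> memory \<Rightarrow> nat" where
  "aval (Num i) s = i"
| "aval (Cell x es) s = s x (map (\<lambda>e. aval e s) es)"
| "aval (Plus a b) s = aval a s + aval b s"
| "aval (Minus a b) s = aval a s - aval b s"

fun bval :: "bexp \<Rightarrow> memory \<Rightarrow> bool" where
  "bval (Less a b) s \<longleftrightarrow> aval a s < aval b s"
| "bval (Equal a b) s \<longleftrightarrow> aval a s = aval b s"
| "bval (Neg b) s \<longleftrightarrow> \<not> bval b s"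
| "bval (Conj b c) s \<longleftrightarrow> bval b s \<and> bval c s"

definition store :: "memory \<Rightarrow> string \<Rightarrow> nat list \<Rightarrow> nat \<Rightarrow> memory" where
  "store s x is i = s(x := (s x)(is := i))"

text \<open>\<open>runs c s t s'\<close>: started in memory \<open>s\<close>, the program \<open>c\<close> halts after \<open>t\<close> steps with
  memory \<open>s'\<close>.\<close>

inductive runs :: "com \<Rightarrow> memory \<Rightarrow> nat \<Rightarrow> memory \<Rightarrow> bool" where
  Skip: "runs Skip s 1 s"
| Assign: "runs (Assign x es e) s 1 (store s x (map (\<lambda>e. aval e s) es) (aval e s))"
| Seq: "runs c s t s' \<Longrightarrow> runs d s' t' s'' \<Longrightarrow> runs (Seq c d) s (t + t') s''"
| IfTrue: "bval b s \<Longrightarrow> runs c s t s' \<Longrightarrow> runs (If b c d) s (Suc t) s'"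
| IfFalse: "\<not> bval b s \<Longrightarrow> runs d s t s' \<Longrightarrow> runs (If b c d) s (Suc t) s'"
| WhileFalse: "\<not> bval b s \<Longrightarrow> runs (While b c) s 1 s"
| WhileTrue: "bval b s \<Longrightarrow> runs c s t s' \<Longrightarrow> runs (While b c) s' t' s'' \<Longrightarrow>
    runs (While b c) s (Suc (t + t')) s''"

inductive_cases runs_SkipE: "runs Skip s t s'"
  and runs_AssignE: "runs (Assign x es e) s t s'"
  and runs_SeqE: "runs (Seq c d) s t s'"
  and runs_IfE: "runs (If b c d) s t s'"
  and runs_WhileE: "runs (While b c) s t s'"

text \<open>Programs are deterministic, so the existence of a run with some property says that the
  run of the program has that property.\<close>

lemma runs_deterministic:
  "runs c s t s' \<Longrightarrow> runs c s u r \<Longrightarrow> u = t \<and> r = s'"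
proof (induction arbitrary: u r rule: runs.induct)
  case (Seq c s t s' d t' s'')
  from Seq.prems Seq.IH show ?case by (blast elim: runs_SeqE)
next
  case (IfTrue b s c t s' d)
  from IfTrue.prems IfTrue.IH IfTrue.hyps show ?case by (blast elim: runs_IfE)
next
  case (IfFalse b s d t s' c)
  from IfFalse.prems IfFalse.IH IfFalse.hyps show ?case by (blast elim: runs_IfE)
next
  case (WhileTrue b s c t s' t' s'')
  from WhileTrue.prems WhileTrue.IH WhileTrue.hyps show ?case by (blast elim: runs_WhileE)
qed (auto elim: runs_SkipE runs_AssignE runs_WhileE)

text \<open>Encoding of the input: the vertices are the numbers below |V| and colours are arbitrary
  numbers. The scalars \<open>n\<close> and \<open>k\<close> hold |V| and k, the array \<open>E\<close> is the adjacency matrix, and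
  the row \<open>v\<close> of the array \<open>S\<close> lists the elements of S(v), given as the list \<open>L v\<close>.
  All other cells are 0.\<close>

definition input :: "nat pair_pre_digraph \<Rightarrow> nat \<Rightarrow> (nat \<Rightarrow> nat list) \<Rightarrow> memory" where
  "input D k L x is =
    (if x = ''n'' \<and> is = [] then card (pverts D)
     else if x = ''k'' \<and> is = [] then k
     else case is of
       [u, v] \<Rightarrow>
         if x = ''E'' \<and> (u, v) \<in> parcs D then 1
         else if x = ''S'' \<and> u \<in> pverts D \<and> v < length (L u) then L u ! v
         else 0
     | _ \<Rightarrow> 0)"

text \<open>The set C(v) is read off from the first k cells of row \<open>v\<close> of the array \<open>C\<close>.\<close>

definition computed_choice :: "nat \<Rightarrow> memory \<Rightarrow> nat \<Rightarrow> nat set" where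
  "computed_choice k s v = (\<lambda>i. s ''C'' [v, i]) ` {..<k}"

end

theory Submission
  imports Defs
begin

text \<open>If \<open>q v\<close> counts the colours that \<open>v\<close> still needs and \<open>M v\<close> is what is left of \<open>S(v)\<close>, keep
  \<open>card (M v) \<ge> q v + (\<Sum>u. q u)\<close>, summing over the out-neighbours of \<open>v\<close>, as long as \<open>q v > 0\<close>. To
  process a colour \<open>c\<close>, take a kernel of the subdigraph induced by the vertices that may use \<open>c\<close>
  and still need colours, give \<open>c\<close> to the kernel and delete \<open>c\<close> everywhere: a vertex outside the
  kernel loses one colour, but so does the demand of some out-neighbour. When all colours are used
  up, no demand is left.

  Without odd dicycles a kernel always exists (Richardson). In a strong component that no arc
  leaves, the vertices reached from a fixed vertex by walks of even length are independent, and
  all other vertices of the component have an arc into this class. Take the class, delete it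
  together with its in-neighbours, and repeat.

  The program implements this with counting loops bounded by \<open>n\<close> and \<open>k\<close> only, so its running time
  is polynomial for syntactic reasons.\<close>

section \<open>Walks and their parity\<close>

text \<open>The hypothesis speaks of simple cycles, but concatenated walks need not be simple. It is
  therefore turned once into the absence of odd closed walks, a property that passes to every
  subdigraph and so serves every colour and every stage of each kernel. Only the parity of a walk
  matters, so the question becomes reachability in a finite relation on twice as many vertices,
  which the program can tabulate.

  Running time and correctness of the program are proved apart. The time bound provides a halting
  run from every memory with \<open>n + k >= 1\<close>, whatever the other cells contain;
  correctness speaks only about the final memory of a halting run, and there the absence of odd
  cycles enters.\<close>

text \<open>This is the bipartite double cover: every arc flips the Boolean component, so the parity
  of a walk is recorded in its end point.\<close>

definition parity_cover :: "'a rel \<Rightarrow> ('a \<times> bool) rel" where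
  "parity_cover E = {((u, p), (w, \<not> p)) | u w p. (u, w) \<in> E}"

text \<open>\<open>parity_walk E p u w\<close>: there is a walk from \<open>u\<close> to \<open>w\<close> whose length is odd iff \<open>p\<close>.\<close>

definition parity_walk :: "'a rel \<Rightarrow> bool \<Rightarrow> 'a \<Rightarrow> 'a \<Rightarrow> bool" where
  "parity_walk E p u w \<longleftrightarrow> ((u, False), (w, p)) \<in> (parity_cover E)\<^sup>*"

lemma parity_walk_refl: "parity_walk E False u u"
  by (simp add: parity_walk_def)

lemma parity_walk_step: "parity_walk E p u w \<Longrightarrow> (w, x) \<in> E \<Longrightarrow> parity_walk E (\<not> p) u x"
  unfolding parity_walk_def by (rule rtrancl_into_rtrancl) (auto simp: parity_cover_def)

lemma parity_walk_edge: "(u, w) \<in> E \<Longrightarrow> parity_walk E True u w"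
  using parity_walk_step[OF parity_walk_refl] by force

lemma parity_walk_induct [consumes 1, case_names refl step]:
  assumes "parity_walk E p u w"
    and "P False u"
    and "\<And>p w x. parity_walk E p u w \<Longrightarrow> P p w \<Longrightarrow> (w, x) \<in> E \<Longrightarrow> P (\<not> p) x"
  shows "P p w"
  using assms(1) unfolding parity_walk_def
proof (induction rule: rtrancl_induct2)
  case refl
  show ?case by (rule assms(2))
next
  case (step w p x q)
  then show ?case using assms(3)[of p w x] by (auto simp: parity_cover_def parity_walk_def)
qed

lemma parity_walk_trans:
  assumes "parity_walk E p u w" "parity_walk E q w x"
  shows "parity_walk E (p \<noteq> q) u x"
  using assms(2)
proof (induction rule: parity_walk_induct)
  case refl
  then show ?case using assms(1) by simp
next
  case (step q x y)
  then show ?case using parity_walk_step[of E "p \<noteq> q" u x y] by (cases p; cases q) auto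
qed

text \<open>Walks are built by appending arcs at the end; here the first arc is split off, by
  induction on the appended arcs.\<close>

lemma parity_walk_first_step:
  assumes "parity_walk E p u w"
  shows "u = w \<and> \<not> p \<or> (\<exists>z. (u, z) \<in> E \<and> parity_walk E (\<not> p) z w)"
  using assms
proof (induction rule: parity_walk_induct)
  case refl
  then show ?case by simp
next
  case (step p w x)
  show ?case
  proof (cases "u = w \<and> \<not> p")
    case True
    then have "(u, x) \<in> E" "parity_walk E (\<not> \<not> p) x x"
      using step.hyps(2) by (simp_all add: parity_walk_refl)
    then show ?thesis by blast
  next
    case False
    then obtain z where "(u, z) \<in> E" "parity_walk E (\<not> p) z w" using step.IH by blast
    then show ?thesis using parity_walk_step[of E "\<not> p" z w x] step.hyps(2) by blast
  qed
qed

lemma parity_walk_mono: "parity_walk E p u w \<Longrightarrow> E \<subseteq> F \<Longrightarrow> parity_walk F p u w"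
  by (induction rule: parity_walk_induct) (auto intro: parity_walk_refl parity_walk_step)

lemma parity_walk_Restr_mem:
  assumes "parity_walk (Restr E A) p u w" "u \<in> A"
  shows "w \<in> A"
  using assms by (induction rule: parity_walk_induct) auto

section \<open>Odd closed walks and odd directed cycles\<close>

definition odd_closed_free :: "'a rel \<Rightarrow> bool" where
  "odd_closed_free E \<longleftrightarrow> (\<forall>u. \<not> parity_walk E True u u)"

text \<open>A closed walk that repeats a vertex splits into two shorter closed walks whose lengths
  add up to an odd number, so one of them is odd; induct on the length.\<close>

lemma (in wf_digraph) odd_closed_walk_has_odd_cycle:
  assumes "awalk u p u" "odd (length p)"
  shows "has_odd_dicycle G"
  using assms
proof (induction "length p" arbitrary: u p rule: less_induct)
  case less
  \<comment> \<open>A cycle must have distinct vertices only after its starting vertex, which recurs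
    at the end. Hence repetitions are sought in the walk without its first arc.\<close>
  then obtain e es where p: "p = e # es" by (cases p) auto
  have es: "awalk (head G e) es u" and e: "e \<in> arcs G" "u = tail G e"
    using less.prems(1) unfolding p by (auto simp: awalk_Cons_iff)
  show ?case
  proof (cases "distinct (awalk_verts (head G e) es)")
    case True
    then have "distinct (tl (awalk_verts u p))"
      unfolding p by simp
    then show ?thesis
      using less.prems p unfolding has_odd_dicycle_def cycle_def by blast
  next
    case False
    then obtain q r s w where es_eq: "es = q @ r @ s" and w: "awalk (head G e) q w"
      "awalk w r w" "awalk w s u" and "closed_w r"
      using es by (elim awalk_cyc_decompE') auto
    have r: "r \<noteq> []" using \<open>closed_w r\<close> by (auto simp: closed_w_def)
    have qs: "awalk u (e # q @ s) u"
      using e w by (auto simp: awalk_Cons_iff intro: awalk_appendI)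
    show ?thesis
    proof (cases "odd (length r)")
      case True
      then show ?thesis using less.hyps[of r w] w p es_eq by simp
    next
      case False
      then have "odd (length (e # q @ s))" using less.prems(2) p es_eq by auto
      then show ?thesis using less.hyps[of "e # q @ s" u] qs p es_eq r by simp
    qed
  qed
qed

lemma (in pair_wf_digraph) odd_closed_free_parcs:
  assumes "\<not> has_odd_dicycle (with_proj G)"
  shows "odd_closed_free (parcs G)"
proof -
  have walk: "u = w \<and> \<not> p \<or> (\<exists>ps. awalk u ps w \<and> odd (length ps) = p)"
    if "parity_walk (parcs G) p u w" for p u w
    using that
  proof (induction rule: parity_walk_induct)
    case refl
    then show ?case by simp
  next
    case (step p w x)
    have wx: "awalk w [(w, x)] x"
      using step.hyps(2) by (auto simp: awalk_def dest: in_arcsD1)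
    from step.IH show ?case
    proof
      assume "u = w \<and> \<not> p"
      then show ?thesis using wx by (intro disjI2 exI[of _ "[(w, x)]"]) auto
    next
      assume "\<exists>ps. awalk u ps w \<and> odd (length ps) = p"
      then obtain ps where "awalk u ps w" "odd (length ps) = p" by blast
      then show ?thesis using wx
        by (intro disjI2 exI[of _ "ps @ [(w, x)]"]) (auto intro: awalk_appendI)
    qed
  qed
  show ?thesis
    unfolding odd_closed_free_def using walk assms odd_closed_walk_has_odd_cycle by blast
qed

section \<open>Terminal strong components\<close>

text \<open>Such an \<open>x\<close> lies in a strong component of the subdigraph induced by
  \<open>A\<close> that no arc leaves.\<close>

definition sink_vertex :: "'a rel \<Rightarrow> 'a set \<Rightarrow> 'a \<Rightarrow> bool" where
  "sink_vertex E A x \<longleftrightarrow> x \<in> A \<and>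
     (\<forall>p w. parity_walk (Restr E A) p x w \<longrightarrow> (\<exists>q. parity_walk (Restr E A) q w x))"

text \<open>Take \<open>x\<close> whose set of reachable vertices is smallest. A vertex
  \<open>w\<close> reached from \<open>x\<close> reaches a subset of that set, hence all of it, and
  so also \<open>x\<close>.\<close>

lemma sink_vertex_exists:
  assumes "finite A" "A \<noteq> {}"
  shows "\<exists>x. sink_vertex E A x"
proof -
  define reach where "reach x = {w. \<exists>p. parity_walk (Restr E A) p x w}" for x
  obtain x where x: "x \<in> A" "\<And>y. y \<in> A \<Longrightarrow> card (reach x) \<le> card (reach y)"
    using arg_min_if_finite[OF assms, of "\<lambda>x. card (reach x)"]
    by (metis linorder_not_less)
  have "\<exists>q. parity_walk (Restr E A) q w x" if w: "parity_walk (Restr E A) p x w" for p w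
  proof -
    have "w \<in> A" using parity_walk_Restr_mem[OF w] x by blast
    moreover have "reach w \<subseteq> reach x"
      unfolding reach_def using parity_walk_trans[OF w] by blast
    moreover have "finite (reach x)"
      using assms(1) by (rule rev_finite_subset)
        (use x in \<open>auto simp: reach_def dest: parity_walk_Restr_mem\<close>)
    ultimately have "reach w = reach x"
      using x(2) by (metis card_seteq)
    then show ?thesis unfolding reach_def using parity_walk_refl by fast
  qed
  then show ?thesis unfolding sink_vertex_def using x by blast
qed

section \<open>Kernels\<close>

definition kernel :: "'a rel \<Rightarrow> 'a set \<Rightarrow> 'a set \<Rightarrow> bool" where
  "kernel E A K \<longleftrightarrow> K \<subseteq> A \<and> E \<inter> K \<times> K = {} \<and> (\<forall>v \<in> A - K. \<exists>w \<in> K. (v, w) \<in> E)"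

text \<open>\<open>A\<close> is the set of the vertices of \<open>B\<close> that are still undecided.\<close>

definition partial_kernel :: "'a rel \<Rightarrow> 'a set \<Rightarrow> 'a set \<Rightarrow> 'a set \<Rightarrow> bool" where
  "partial_kernel E B A K \<longleftrightarrow> A \<subseteq> B \<and> K \<subseteq> B - A \<and>
     E \<inter> K \<times> K = {} \<and> E \<inter> K \<times> A = {} \<and> E \<inter> A \<times> K = {} \<and>
     (\<forall>v \<in> B - A - K. \<exists>w \<in> K. (v, w) \<in> E)"

definition even_reach :: "'a rel \<Rightarrow> 'a set \<Rightarrow> 'a \<Rightarrow> 'a set" where
  "even_reach E A x = {w. parity_walk (Restr E A) False x w}"

text \<open>Every vertex reached from \<open>x\<close> can return, so two walks of different parity
  to the same vertex would close up to an odd closed walk. Thus the reached vertices split into an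
  even and an odd class: no arc joins two even vertices, and every odd vertex has an arc to an even
  one.\<close>

lemma partial_kernel_step:
  assumes free: "odd_closed_free E" and pk: "partial_kernel E B A K" and x: "sink_vertex E A x"
    and K': "K' = K \<union> even_reach E A x" and A': "A' = A - K' - E\<inverse> `` K'"
  shows "partial_kernel E B A' K'"
proof -
  let ?F = "Restr E A"
  have xA: "x \<in> A" and return: "\<And>p w. parity_walk ?F p x w \<Longrightarrow> \<exists>q. parity_walk ?F q w x"
    using x by (auto simp: sink_vertex_def)
  have no_odd: "\<not> parity_walk ?F True v v" for v
    using free parity_walk_mono[of ?F True v v E] by (auto simp: odd_closed_free_def)
  \<comment> \<open>A walk and any walk back have equal parity, since their concatenation is closed
    and thus even.\<close>
  have same: "q = p" if "parity_walk ?F p x w" "parity_walk ?F q w x" for p q w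
    using parity_walk_trans[OF that] no_odd[of x] by (cases p; cases q) auto
  have sub: "even_reach E A x \<subseteq> A"
    using parity_walk_Restr_mem xA by (fastforce simp: even_reach_def)
  have unique: "p = q" if "parity_walk ?F p x w" "parity_walk ?F q x w" for p q w
    using that return same by blast
  have indep: "(y, z) \<notin> E" if "y \<in> even_reach E A x" "z \<in> even_reach E A x" for y z
  proof
    assume "(y, z) \<in> E"
    then have "(y, z) \<in> ?F" using that sub by blast
    then show False
      using parity_walk_step[of ?F False x y z] unique[of False z True] that
      by (auto simp: even_reach_def)
  qed
  have dominated: "z \<in> even_reach E A x \<or> (\<exists>w \<in> even_reach E A x. (z, w) \<in> E)"
    if z: "parity_walk ?F p x z" for p z
  proof (cases p)
    case False
    then show ?thesis using z by (simp add: even_reach_def)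
  next
    case True
    then have "parity_walk ?F True z x" using return[OF z] same[OF z] True by metis
    moreover have "z \<noteq> x" using calculation no_odd by auto
    \<comment> \<open>The first arc of the odd way back leads to a vertex \<open>w\<close>.
      Appending this arc to the odd walk from \<open>x\<close> to \<open>z\<close> shows that
      \<open>w\<close> is in the even class.\<close>
    ultimately obtain w where w: "(z, w) \<in> ?F" "parity_walk ?F False w x"
      using parity_walk_first_step[of ?F True z x] by auto
    have "parity_walk ?F False x w" using parity_walk_step[OF z w(1)] True by simp
    then show ?thesis using w by (auto simp: even_reach_def)
  qed
  \<comment> \<open>An out-neighbour of the even class inside \<open>A\<close> is itself reached
    from \<open>x\<close>, hence in the class or an in-neighbour of it, and so already
    deleted.\<close>
  have out: "(y, z) \<notin> E" if "y \<in> even_reach E A x" "z \<in> A'" for y z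
  proof
    assume "(y, z) \<in> E"
    then have "(y, z) \<in> ?F" using that sub A' by blast
    then have "parity_walk ?F True x z"
      using parity_walk_step[of ?F False x y z] that by (simp add: even_reach_def)
    from dominated[OF this] show False using that(2) unfolding A' K' by blast
  qed
  show ?thesis
    unfolding partial_kernel_def
  proof (intro conjI ballI)
    have AB: "A \<subseteq> B" "K \<subseteq> B" using pk unfolding partial_kernel_def by blast+
    show "A' \<subseteq> B" using AB(1) unfolding A' by blast
    have "K' \<subseteq> B" using AB sub unfolding K' by blast
    then show "K' \<subseteq> B - A'" unfolding A' by blast
    show "E \<inter> A' \<times> K' = {}" unfolding A' by blast
    have KA: "E \<inter> K \<times> A = {}" "E \<inter> A \<times> K = {}" "E \<inter> K \<times> K = {}"
      using pk unfolding partial_kernel_def by blast+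
    then show "E \<inter> K' \<times> K' = {}" using sub indep unfolding K' by blast
    have "A' \<subseteq> A" unfolding A' by blast
    then show "E \<inter> K' \<times> A' = {}" using KA out unfolding K' by blast
  next
    fix v assume v: "v \<in> B - A' - K'"
    show "\<exists>w \<in> K'. (v, w) \<in> E"
    proof (cases "v \<in> A")
      case True
      then show ?thesis using v unfolding A' by blast
    next
      case False
      then have "v \<in> B - A - K" using v unfolding K' by blast
      then show ?thesis using pk unfolding partial_kernel_def K' by blast
    qed
  qed
qed

lemma partial_kernel_initial: "partial_kernel E A A {}"
  by (simp add: partial_kernel_def)

lemma kernel_if_partial_kernel: "partial_kernel E A {} K \<Longrightarrow> kernel E A K"
  by (auto simp: partial_kernel_def kernel_def)

lemma sink_vertex_in_even_reach: "sink_vertex E A x \<Longrightarrow> x \<in> A \<inter> even_reach E A x"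
  by (simp add: sink_vertex_def even_reach_def parity_walk_refl)

lemma kernel_exists:
  assumes "odd_closed_free E" "finite B"
  shows "\<exists>K. kernel E B K"
proof -
  have "\<exists>K. kernel E B K" if "finite A" "partial_kernel E B A K" for A K
    using that
  proof (induction A arbitrary: K rule: finite_psubset_induct)
    case (psubset A)
    show ?case
    proof (cases "A = {}")
      case True
      then show ?thesis using psubset.prems kernel_if_partial_kernel by blast
    next
      case False
      then obtain x where x: "sink_vertex E A x" using sink_vertex_exists psubset.hyps by blast
      let ?K = "K \<union> even_reach E A x"
      have "A - ?K - E\<inverse> `` ?K \<subset> A" using sink_vertex_in_even_reach[OF x] by blast
      then show ?thesis
        using psubset.IH partial_kernel_step[OF assms(1) psubset.prems x] by blast
    qed
  qed
  then show ?thesis using assms(2) partial_kernel_initial by blast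
qed

section \<open>Choosing colours greedily\<close>

text \<open>At demand 0 a vertex is never active, so its list may shrink although no demand around
  it drops; hence the bound only at positive demand. The third line reflects that a colour, once
  chosen, is deleted from all lists, not only from adjacent ones.\<close>

definition partial_choice ::
    "'a rel \<Rightarrow> 'a set \<Rightarrow> nat \<Rightarrow> ('a \<Rightarrow> 'c set) \<Rightarrow> ('a \<Rightarrow> nat) \<Rightarrow> ('a \<Rightarrow> 'c set) \<Rightarrow> ('a \<Rightarrow> 'c set) \<Rightarrow> bool"
  where
  "partial_choice E V k S q M C \<longleftrightarrow>
     (\<forall>v \<in> V. M v \<subseteq> S v \<and> (0 < q v \<longrightarrow> q v + (\<Sum>u \<in> E `` {v}. q u) \<le> card (M v))) \<and>
     (\<forall>v \<in> V. C v \<subseteq> S v \<and> finite (C v) \<and> card (C v) + q v = k) \<and>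
     (\<forall>v \<in> V. \<forall>w \<in> V. C v \<inter> M w = {}) \<and>
     (\<forall>(u, v) \<in> E. C u \<inter> C v = {})"

text \<open>The functions read off from the memory of the program agree with the abstract ones only
  on \<open>V\<close>; arcs stay inside \<open>V\<close>, so neither the sums nor the disjointness
  see anything else.\<close>

lemma partial_choice_cong:
  assumes "E \<subseteq> V \<times> V" "\<And>v. v \<in> V \<Longrightarrow> q v = q' v \<and> M v = M' v \<and> C v = C' v"
  shows "partial_choice E V k S q M C = partial_choice E V k S q' M' C'"
proof -
  have "(\<Sum>u \<in> E `` {v}. q u) = (\<Sum>u \<in> E `` {v}. q' u)" for v
    by (rule sum.cong) (use assms in auto)
  moreover have "(\<forall>(u, v) \<in> E. C u \<inter> C v = {}) = (\<forall>(u, v) \<in> E. C' u \<inter> C' v = {})"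
  proof (intro ball_cong refl)
    fix e assume "e \<in> E"
    then obtain u v where "e = (u, v)" "u \<in> V" "v \<in> V" using assms(1) by auto
    then show "(case e of (u, v) \<Rightarrow> C u \<inter> C v = {}) = (case e of (u, v) \<Rightarrow> C' u \<inter> C' v = {})"
      using assms(2) by simp
  qed
  ultimately show ?thesis
    unfolding partial_choice_def using assms(2) by (auto cong: ball_cong)
qed

lemma partial_choice_step:
  assumes E: "E \<subseteq> V \<times> V" and V: "finite V" and S: "\<And>v. v \<in> V \<Longrightarrow> finite (S v)"
    and pc: "partial_choice E V k S q M C"
    and K: "kernel E {v \<in> V. c \<in> M v \<and> 0 < q v} K"
  shows "partial_choice E V k S (\<lambda>v. if v \<in> K then q v - 1 else q v) (\<lambda>v. M v - {c})
           (\<lambda>v. if v \<in> K then insert c (C v) else C v)"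
proof -
  let ?q = "\<lambda>v. if v \<in> K then q v - 1 else q v"
  have KV: "v \<in> V" "c \<in> M v" "0 < q v" if "v \<in> K" for v
    using that K by (auto simp: kernel_def)
  have M: "M v \<subseteq> S v" "0 < q v \<Longrightarrow> q v + (\<Sum>u \<in> E `` {v}. q u) \<le> card (M v)" if "v \<in> V" for v
    using pc that by (auto simp: partial_choice_def)
  have C: "C v \<subseteq> S v" "finite (C v)" "card (C v) + q v = k" if "v \<in> V" for v
    using pc that by (auto simp: partial_choice_def)
  have disj: "C v \<inter> M w = {}" if "v \<in> V" "w \<in> V" for v w
    using pc that by (auto simp: partial_choice_def)
  have bound: "?q v + (\<Sum>u \<in> E `` {v}. ?q u) \<le> card (M v - {c})" if v: "v \<in> V" "0 < ?q v" for v
  proof -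
    have fin: "finite (E `` {v})" using E V by (auto intro: rev_finite_subset)
    have le: "(\<Sum>u \<in> E `` {v}. ?q u) \<le> (\<Sum>u \<in> E `` {v}. q u)"
      by (intro sum_mono) simp
    have finM: "finite (M v)" using M(1)[OF v(1)] S[OF v(1)] by (rule finite_subset)
    have q: "0 < q v" using v(2) by (auto split: if_splits)
    \<comment> \<open>Either \<open>v\<close> does not lose \<open>c\<close>, or \<open>v\<close>
      pays for the loss with its own demand, or \<open>v\<close> is active outside the kernel and
      the demand of an out-neighbour \<open>w\<close> in the kernel pays.\<close>
    consider "c \<notin> M v" | "v \<in> K" | w where "c \<in> M v" "v \<notin> K" "w \<in> K" "(v, w) \<in> E"
      using K v(1) q unfolding kernel_def by blast
    then show ?thesis
    proof cases
      case 1
      have "?q v + (\<Sum>u \<in> E `` {v}. ?q u) \<le> q v + (\<Sum>u \<in> E `` {v}. q u)"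
        by (rule add_mono[OF _ le]) simp
      also have "\<dots> \<le> card (M v)" using M(2)[OF v(1) q] .
      also have "\<dots> = card (M v - {c})" using 1 by simp
      finally show ?thesis .
    next
      case 2
      then show ?thesis using le M(2)[OF v(1) q] KV[OF 2] finM by simp
    next
      case (3 w)
      \<comment> \<open>Kernel vertices have positive demand, so the truncated subtraction at
        \<open>w\<close> really decreases the sum.\<close>
      have "(\<Sum>u \<in> E `` {v}. ?q u) < (\<Sum>u \<in> E `` {v}. q u)"
        using fin 3 KV by (intro sum_strict_mono_ex1) auto
      then show ?thesis using M(2)[OF v(1) q] 3 finM by simp
    qed
  qed
  have card: "card (if v \<in> K then insert c (C v) else C v) + ?q v = k" if v: "v \<in> V" for v
  proof (cases "v \<in> K")
    case True
    then have "c \<notin> C v" using KV disj by blast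
    then show ?thesis using True C[OF v] KV[OF True] by simp
  qed (use C[OF v] in simp)
  have indep: "(u, v) \<notin> E" if "u \<in> K" "v \<in> K" for u v
    using K that by (auto simp: kernel_def)
  have adj: "(if u \<in> K then insert c (C u) else C u) \<inter> (if v \<in> K then insert c (C v) else C v) = {}"
    if "(u, v) \<in> E" for u v
  proof -
    have "C u \<inter> C v = {}" using pc that by (auto simp: partial_choice_def)
    \<comment> \<open>The colour is still in \<open>M w\<close> for a kernel vertex
      \<open>w\<close>, and chosen sets are disjoint from all of \<open>M w\<close>; so
      \<open>c\<close> is new to both sets.\<close>
    moreover have "c \<notin> C u \<and> c \<notin> C v" if "u \<in> K \<or> v \<in> K"
    proof -
      have uv: "u \<in> V" "v \<in> V" using E \<open>(u, v) \<in> E\<close> by auto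
      obtain w where "w \<in> V" "c \<in> M w" using \<open>u \<in> K \<or> v \<in> K\<close> KV by blast
      then show ?thesis using disj[OF uv(1), of w] disj[OF uv(2), of w] by blast
    qed
    ultimately show ?thesis using indep[of u v] that by auto
  qed
  show ?thesis
    unfolding partial_choice_def
  proof (intro conjI ballI)
    fix v w assume "v \<in> V" "w \<in> V"
    then show "(if v \<in> K then insert c (C v) else C v) \<inter> (M w - {c}) = {}"
      using disj[of v w] by auto
  next
    fix e assume "e \<in> E"
    then show "case e of (u, v) \<Rightarrow>
        (if u \<in> K then insert c (C u) else C u) \<inter> (if v \<in> K then insert c (C v) else C v) = {}"
      using adj by (cases e) blast
  next
    fix v assume v: "v \<in> V"
    show "(if v \<in> K then insert c (C v) else C v) \<subseteq> S v"
      using KV[of v] M(1)[OF v] C(1)[OF v] by auto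
  qed (use bound card M C in auto)
qed

text \<open>Here the size of the lists is used: initially the bound asks for \<open>k\<close>
  colours for the vertex and \<open>k\<close> for each out-neighbour, and it holds with
  equality.\<close>

lemma partial_choice_initial:
  assumes "finite V" "E \<subseteq> V \<times> V"
    and "\<And>v. v \<in> V \<Longrightarrow> card (S v) = k * (card (E `` {v}) + 1)"
  shows "partial_choice E V k S (\<lambda>_. k) S (\<lambda>_. {})"
  using assms by (auto simp: partial_choice_def algebra_simps)

lemma partial_choice_final:
  assumes "partial_choice E V k S q M C" "\<And>v. v \<in> V \<Longrightarrow> M v = {}" "v \<in> V"
  shows "q v = 0"
  using assms by (fastforce simp: partial_choice_def)

lemma colour_choice_if_partial_choice:
  assumes "partial_choice (parcs D) (pverts D) k S q M C" "\<And>v. v \<in> pverts D \<Longrightarrow> M v = {}"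
  shows "colour_choice (with_proj D) k S C"
proof -
  have "q v = 0" if "v \<in> pverts D" for v
    using partial_choice_final[OF assms(1) _ that] assms(2) by blast
  then show ?thesis
    using assms(1) by (fastforce simp: partial_choice_def colour_choice_def adjacent_def)
qed

lemma (in pair_fin_digraph) out_degree_eq: "out_degree (with_proj G) v = card (parcs G `` {v})"
proof -
  have "bij_betw snd (out_arcs (with_proj G) v) (parcs G `` {v})"
    by (rule bij_betw_byWitness[where f' = "\<lambda>u. (v, u)"]) (auto simp: out_arcs_def)
  then show ?thesis by (simp add: out_degree_def bij_betw_same_card)
qed

lemma (in pair_fin_digraph) colour_choice_exists:
  assumes S: "\<And>v. v \<in> pverts G \<Longrightarrow>
      finite (S v) \<and> card (S v) = k * (out_degree (with_proj G) v + 1)"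
    and odd: "\<not> has_odd_dicycle (with_proj G)"
  shows "\<exists>C. colour_choice (with_proj G) k S C"
proof -
  have E: "parcs G \<subseteq> pverts G \<times> pverts G" by (auto dest: in_arcsD1 in_arcsD2)
  have V: "finite (pverts G)" by simp
  \<comment> \<open>\<open>U\<close> is the set of colours already processed; with all colours of
    all lists in \<open>U\<close>, nothing is left of any list.\<close>
  have "\<exists>q M C. partial_choice (parcs G) (pverts G) k S q M C \<and> (\<forall>v \<in> pverts G. M v \<inter> U = {})"
    if "finite U" for U
    using that
  proof (induction U rule: finite_induct)
    case empty
    show ?case
      using partial_choice_initial[OF V E, of S k] S by (auto simp: out_degree_eq)
  next
    case (insert c U)
    then obtain q M C where pc: "partial_choice (parcs G) (pverts G) k S q M C"
      and M: "\<forall>v \<in> pverts G. M v \<inter> U = {}" by blast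
    obtain K where K: "kernel (parcs G) {v \<in> pverts G. c \<in> M v \<and> 0 < q v} K"
      using kernel_exists[OF odd_closed_free_parcs[OF odd]] V by (metis finite_Collect_conjI Collect_mem_eq)
    have "partial_choice (parcs G) (pverts G) k S (\<lambda>v. if v \<in> K then q v - 1 else q v)
        (\<lambda>v. M v - {c}) (\<lambda>v. if v \<in> K then insert c (C v) else C v)"
      by (rule partial_choice_step[OF E V _ pc K]) (use S in blast)
    moreover have "\<forall>v \<in> pverts G. (M v - {c}) \<inter> insert c U = {}"
      using M by auto
    ultimately show ?case by blast
  qed
  from this[of "\<Union> (S ` pverts G)"] obtain q M C
    where pc: "partial_choice (parcs G) (pverts G) k S q M C"
      and M: "\<forall>v \<in> pverts G. M v \<inter> \<Union> (S ` pverts G) = {}"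
    using S V by auto
  have "M v = {}" if "v \<in> pverts G" for v
    using pc M that unfolding partial_choice_def by blast
  then show ?thesis using colour_choice_if_partial_choice[OF pc] by blast
qed

section \<open>Programs with counting loops\<close>

primrec assigned :: "com \<Rightarrow> string set" where
  "assigned Skip = {}"
| "assigned (Assign x es e) = {x}"
| "assigned (Seq c d) = assigned c \<union> assigned d"
| "assigned (If b c d) = assigned c \<union> assigned d"
| "assigned (While b c) = assigned c"

lemma runs_unassigned: "runs c s t s' \<Longrightarrow> z \<notin> assigned c \<Longrightarrow> s' z = s z"
  by (induction rule: runs.induct) (auto simp: store_def)

text \<open>The bound \<open>y\<close> is read again at every test. The rules for this loop
  therefore forbid the body to assign \<open>x\<close> or \<open>y\<close>.\<close>

definition For :: "string \<Rightarrow> string \<Rightarrow> com \<Rightarrow> com" where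
  "For x y c = Seq (Assign x [] (Num 0))
     (While (Less (Cell x []) (Cell y [])) (Seq c (Assign x [] (Plus (Cell x []) (Num 1)))))"

lemma assigned_For [simp]: "assigned (For x y c) = insert x (assigned c)"
  by (auto simp: For_def)

lemma store_same [simp]: "store s x is i x = (s x)(is := i)"
  and store_other [simp]: "y \<noteq> x \<Longrightarrow> store s x is i y = s y"
  by (simp_all add: store_def)

abbreviation Disj :: "bexp \<Rightarrow> bexp \<Rightarrow> bexp" where
  "Disj b c \<equiv> Neg (Conj (Neg b) (Neg c))"

subsection \<open>Running time\<close>

definition input_size :: "memory \<Rightarrow> nat" where
  "input_size s = s ''n'' [] + s ''k'' []"

text \<open>Halting is part of the notion, and the bound sees only \<open>n\<close> and
  \<open>k\<close>, not the size of the colours. Size 0 is excluded because \<open>0 ^ b\<close>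
  vanishes for positive \<open>b\<close>.\<close>

definition polytime :: "com \<Rightarrow> bool" where
  "polytime c \<longleftrightarrow> (\<exists>a b. \<forall>s. 1 \<le> input_size s \<longrightarrow>
     (\<exists>t s'. runs c s t s' \<and> t \<le> a * input_size s ^ b))"

lemma polytimeE:
  assumes "polytime c"
  obtains a b where "\<And>s. 1 \<le> input_size s \<Longrightarrow>
    \<exists>t s'. runs c s t s' \<and> t \<le> a * input_size s ^ b"
  using assms unfolding polytime_def by blast

lemma polytime_Skip [intro]: "polytime Skip"
  unfolding polytime_def by (rule exI[of _ 1], rule exI[of _ 0]) (use runs.Skip in force)

lemma polytime_Assign [intro]: "polytime (Assign x es e)"
  unfolding polytime_def by (rule exI[of _ 1], rule exI[of _ 0]) (use runs.Assign in force)

lemma poly_bound_add: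
  fixes m :: nat
  assumes "t \<le> a * m ^ b" "t' \<le> a' * m ^ b'" "1 \<le> m"
  shows "t + t' \<le> (a + a') * m ^ (b + b')"
proof -
  have "m ^ b \<le> m ^ (b + b')" "m ^ b' \<le> m ^ (b + b')"
    using assms(3) by (auto intro: power_increasing)
  then have "a * m ^ b \<le> a * m ^ (b + b')" "a' * m ^ b' \<le> a' * m ^ (b + b')"
    by (auto intro: mult_le_mono2)
  then show ?thesis using assms by (simp only: add_mult_distrib)
qed

text \<open>The time of \<open>d\<close> is measured in the memory left by \<open>c\<close>; as
  \<open>c\<close> preserves \<open>n\<close> and \<open>k\<close>, that is the same input
  size.\<close>

lemma polytime_Seq [intro]:
  assumes c: "polytime c" and d: "polytime d" and nk: "{''n'', ''k''} \<inter> assigned c = {}"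
  shows "polytime (Seq c d)"
proof -
  obtain a b where ab: "\<And>s. 1 \<le> input_size s \<Longrightarrow>
    \<exists>t s'. runs c s t s' \<and> t \<le> a * input_size s ^ b"
    using c by (rule polytimeE) blast
  obtain a' b' where ab': "\<And>s. 1 \<le> input_size s \<Longrightarrow>
    \<exists>t s'. runs d s t s' \<and> t \<le> a' * input_size s ^ b'"
    using d by (rule polytimeE) blast
  have "\<exists>t s'. runs (Seq c d) s t s' \<and> t \<le> (a + a') * input_size s ^ (b + b')"
    if s: "1 \<le> input_size s" for s
  proof -
    obtain t s' where t: "runs c s t s'" "t \<le> a * input_size s ^ b"
      using ab[OF s] by blast
    have eq: "s' ''n'' = s ''n''" "s' ''k'' = s ''k''"
      using runs_unassigned[OF t(1)] nk by auto
    obtain t' s'' where t': "runs d s' t' s''" "t' \<le> a' * input_size s ^ b'"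
      using ab'[of s'] s by (auto simp: input_size_def eq)
    show ?thesis using runs.Seq[OF t(1) t'(1)] poly_bound_add[OF t(2) t'(2) s] by blast
  qed
  then show ?thesis unfolding polytime_def by blast
qed

lemma polytime_If [intro]:
  assumes c: "polytime c" and d: "polytime d"
  shows "polytime (If e c d)"
proof -
  obtain a b where ab: "\<And>s. 1 \<le> input_size s \<Longrightarrow>
    \<exists>t s'. runs c s t s' \<and> t \<le> a * input_size s ^ b"
    using c by (rule polytimeE) blast
  obtain a' b' where ab': "\<And>s. 1 \<le> input_size s \<Longrightarrow>
    \<exists>t s'. runs d s t s' \<and> t \<le> a' * input_size s ^ b'"
    using d by (rule polytimeE) blast
  have "\<exists>t s'. runs (If e c d) s t s' \<and> t \<le> (a + a' + 1) * input_size s ^ (b + b')"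
    if s: "1 \<le> input_size s" for s
  proof -
    let ?m = "input_size s"
    obtain t s' t' s'' where t: "runs c s t s'" "t \<le> a * ?m ^ b"
      and t': "runs d s t' s''" "t' \<le> a' * ?m ^ b'"
      using ab[OF s] ab'[OF s] by blast
    have "t + t' + 1 \<le> (a + a' + 1) * ?m ^ (b + b' + 0)"
      by (rule poly_bound_add[OF poly_bound_add[OF t(2) t'(2) s] _ s]) simp
    then have "Suc t \<le> (a + a' + 1) * ?m ^ (b + b')" "Suc t' \<le> (a + a' + 1) * ?m ^ (b + b')"
      by simp_all
    then show ?thesis
      using runs.IfTrue[OF _ t(1), of e d] runs.IfFalse[OF _ t'(1), of e c] by blast
  qed
  then show ?thesis unfolding polytime_def by blast
qed

lemma polytime_For [intro]:
  assumes c: "polytime c" and y: "y \<in> {''n'', ''k''}"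
    and nk: "{''n'', ''k'', x} \<inter> assigned c = {}" "x \<notin> {''n'', ''k''}"
  shows "polytime (For x y c)"
proof -
  obtain a b where ab: "\<And>s. 1 \<le> input_size s \<Longrightarrow>
    \<exists>t s'. runs c s t s' \<and> t \<le> a * input_size s ^ b"
    using c by (rule polytimeE) blast
  let ?loop = "While (Less (Cell x []) (Cell y [])) (Seq c (Assign x [] (Plus (Cell x []) (Num 1))))"
  \<comment> \<open>Every round costs the body plus two steps for test and increment; the initial
    assignment and the last test cost two more. The constant 4 comes from
    \<open>2 + 2 * m <= 4 * m\<close> for \<open>m >= 1\<close>.\<close>
  have "\<exists>t s'. runs (For x y c) s t s' \<and> t \<le> (a + 4) * input_size s ^ (b + 1)"
    if s: "1 \<le> input_size s" for s
  proof -
    let ?m = "input_size s" and ?N = "s y []"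
    have loop: "\<exists>t s'. runs ?loop r t s' \<and> t \<le> 1 + (?N - r x []) * (a * ?m ^ b + 2)"
      if "r ''n'' = s ''n''" "r ''k'' = s ''k''" for r
      using that
    proof (induction "?N - r x []" arbitrary: r)
      case 0
      then have "\<not> bval (Less (Cell x []) (Cell y [])) r" using y by auto
      from runs.WhileFalse[OF this] show ?case by (metis le_add1)
    next
      case (Suc d)
      have cond: "bval (Less (Cell x []) (Cell y [])) r" using y Suc by auto
      obtain t r' where t: "runs c r t r'" "t \<le> a * ?m ^ b"
        using ab[of r] s Suc.prems by (auto simp: input_size_def)
      have r': "r' ''n'' = s ''n''" "r' ''k'' = s ''k''" "r' x = r x"
        using runs_unassigned[OF t(1)] nk Suc.prems by auto
      let ?r = "store r' x [] (Suc (r x []))"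
      have "runs (Assign x [] (Plus (Cell x []) (Num 1))) r' 1 ?r"
        using runs.Assign[of x "[]" "Plus (Cell x []) (Num 1)" r'] r' by simp
      then have body: "runs (Seq c (Assign x [] (Plus (Cell x []) (Num 1)))) r (t + 1) ?r"
        using t(1) by (blast intro: runs.Seq)
      have "d = ?N - ?r x []" using Suc.hyps(2) by simp
      moreover have "?r ''n'' = s ''n''" "?r ''k'' = s ''k''" using nk r' by auto
      ultimately obtain t' s' where t': "runs ?loop ?r t' s'"
        "t' \<le> 1 + (?N - ?r x []) * (a * ?m ^ b + 2)"
        using Suc.hyps(1)[of ?r] by blast
      have "?N - r x [] = Suc (?N - ?r x [])" using Suc.hyps(2) by simp
      then have "Suc (t + 1 + t') \<le> 1 + (?N - r x []) * (a * ?m ^ b + 2)"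
        using t(2) t'(2) by simp
      then show ?case using runs.WhileTrue[OF cond body t'(1)] by blast
    qed
    have "store s x [] 0 ''n'' = s ''n''" "store s x [] 0 ''k'' = s ''k''"
      using nk by auto
    from loop[OF this] obtain t s' where t: "runs ?loop (store s x [] 0) t s'"
      "t \<le> 1 + (?N - 0) * (a * ?m ^ b + 2)" by auto
    have "runs (Assign x [] (Num 0)) s 1 (store s x [] 0)"
      using runs.Assign[of x "[]" "Num 0" s] by simp
    then have run: "runs (For x y c) s (1 + t) s'"
      using t(1) unfolding For_def by (blast intro: runs.Seq)
    have "1 + t \<le> 2 + ?m * (a * ?m ^ b + 2)"
      using t(2) y mult_le_mono1[of ?N ?m "a * ?m ^ b + 2"] by (auto simp: input_size_def)
    also have "\<dots> = a * ?m ^ (b + 1) + 2 * (1 + ?m)" by (simp add: algebra_simps)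
    also have "2 * (1 + ?m) \<le> 4 * ?m ^ 1" using s by simp
    also have "?m ^ 1 \<le> ?m ^ (b + 1)" using s by (intro power_increasing) auto
    finally have "1 + t \<le> (a + 4) * ?m ^ (b + 1)" by (simp add: algebra_simps)
    then show ?thesis using run by blast
  qed
  then show ?thesis unfolding polytime_def by blast
qed

subsection \<open>Partial correctness\<close>

text \<open>Weakest liberal precondition; as a predicate transformer it lets straight-line code be
  executed symbolically by rewriting.\<close>

definition wlp :: "com \<Rightarrow> memory \<Rightarrow> (memory \<Rightarrow> bool) \<Rightarrow> bool" where
  "wlp c s Q \<longleftrightarrow> (\<forall>t s'. runs c s t s' \<longrightarrow> Q s')"

lemma wlp_Skip [simp]: "wlp Skip s Q \<longleftrightarrow> Q s"
  by (auto simp: wlp_def intro: runs.Skip elim: runs_SkipE)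

lemma wlp_Assign [simp]:
  "wlp (Assign x es e) s Q \<longleftrightarrow> Q (store s x (map (\<lambda>e. aval e s) es) (aval e s))"
  by (auto simp: wlp_def intro: runs.Assign elim: runs_AssignE)

lemma wlp_Seq [simp]: "wlp (Seq c d) s Q \<longleftrightarrow> wlp c s (\<lambda>s'. wlp d s' Q)"
  by (fastforce simp: wlp_def intro: runs.Seq elim: runs_SeqE)

lemma wlp_If [simp]: "wlp (If b c d) s Q \<longleftrightarrow> (if bval b s then wlp c s Q else wlp d s Q)"
  by (auto simp: wlp_def intro: runs.IfTrue runs.IfFalse elim: runs_IfE)

text \<open>Weakening comes with a frame: arrays that \<open>c\<close> does not assign are
  unchanged, so postconditions and invariants need not mention them.\<close>

lemma wlp_conseq:
  assumes "wlp c s Q"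
    and "\<And>s'. Q s' \<Longrightarrow> (\<And>z. z \<notin> assigned c \<Longrightarrow> s' z = s z) \<Longrightarrow> Q' s'"
  shows "wlp c s Q'"
  using assms runs_unassigned unfolding wlp_def by blast

text \<open>\<open>I i\<close> describes the memory at the loop test, where the counter already
  holds \<open>i\<close>; this is why \<open>step\<close> ends with the counter set to
  \<open>Suc i\<close>.\<close>

lemma wlp_For:
  assumes x: "x \<notin> assigned c" and y: "y \<noteq> x" "y \<notin> assigned c"
    and init: "I 0 (store s x [] 0)"
    and step: "\<And>i r. i < s y [] \<Longrightarrow> r x [] = i \<Longrightarrow>
      (\<And>z. z \<noteq> x \<Longrightarrow> z \<notin> assigned c \<Longrightarrow> r z = s z) \<Longrightarrow> I i r \<Longrightarrow>
      wlp c r (\<lambda>r'. I (Suc i) (store r' x [] (Suc i)))"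
    and final: "\<And>r. (\<And>z. z \<noteq> x \<Longrightarrow> z \<notin> assigned c \<Longrightarrow> r z = s z) \<Longrightarrow> I (s y []) r \<Longrightarrow> Q r"
  shows "wlp (For x y c) s Q"
proof -
  let ?frame = "\<lambda>r. \<forall>z. z \<noteq> x \<longrightarrow> z \<notin> assigned c \<longrightarrow> r z = s z"
  have loop: "I (s y []) r'"
    if "runs d r t r'" "d = While (Less (Cell x []) (Cell y []))
        (Seq c (Assign x [] (Plus (Cell x []) (Num 1))))"
      "?frame r" "r x [] \<le> s y []" "I (r x []) r" for d r t r'
    using that
  proof (induction rule: runs.induct)
    case (WhileFalse b r c')
    then have "r x [] = s y []" using y by auto
    then show ?case using WhileFalse by simp
  next
    case (WhileTrue b r c' t r1 t' r2)
    then have c': "c' = Seq c (Assign x [] (Plus (Cell x []) (Num 1)))" and lt: "r x [] < s y []"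
      using y by auto
    obtain t1 r0 where r0: "runs c r t1 r0" and r1: "r1 = store r0 x [] (Suc (r0 x []))"
      using WhileTrue.hyps(2) unfolding c' by (auto elim!: runs_SeqE runs_AssignE)
    have r0x: "r0 z = r z" if "z \<notin> assigned c" for z using runs_unassigned[OF r0 that] .
    have "wlp c r (\<lambda>r'. I (Suc (r x [])) (store r' x [] (Suc (r x []))))"
      using lt WhileTrue.prems by (intro step) auto
    then have "I (r1 x []) r1" using r0 r0x[OF x] unfolding r1 wlp_def by auto
    moreover have "?frame r1" using r0x WhileTrue.prems(2) unfolding r1 by auto
    moreover have "r1 x [] \<le> s y []" using r0x[OF x] lt unfolding r1 by auto
    ultimately show ?case using WhileTrue.IH(2)[OF WhileTrue.prems(1)] by blast
  qed auto
  have "Q r'" if run: "runs (For x y c) s t r'" for t r'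
  proof -
    obtain t' where t': "runs (While (Less (Cell x []) (Cell y []))
        (Seq c (Assign x [] (Plus (Cell x []) (Num 1))))) (store s x [] 0) t' r'"
      using run unfolding For_def by (auto elim!: runs_SeqE runs_AssignE)
    have "I (s y []) r'" by (rule loop[OF t' refl]) (use init in auto)
    moreover have "r' z = s z" if "z \<noteq> x" "z \<notin> assigned c" for z
      using runs_unassigned[OF run] that by simp
    ultimately show ?thesis using final by blast
  qed
  then show ?thesis unfolding wlp_def by blast
qed

text \<open>Indexing the invariant by the set of index pairs already treated replaces two nested
  invariants by one. \<open>stable\<close> says that it ignores the counters.\<close>

lemma wlp_For2:
  assumes vars: "distinct [x, y, n]" "{x, y, n} \<inter> assigned c = {}"
    and init: "I {} s"
    and stable: "\<And>X r z i. z \<in> {x, y} \<Longrightarrow> I X r \<Longrightarrow> I X (store r z [] i)"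
    and step: "\<And>X i j r. i < s n [] \<Longrightarrow> j < s n [] \<Longrightarrow> r x [] = i \<Longrightarrow> r y [] = j \<Longrightarrow>
      (\<And>z. z \<noteq> x \<Longrightarrow> z \<noteq> y \<Longrightarrow> z \<notin> assigned c \<Longrightarrow> r z = s z) \<Longrightarrow> I X r \<Longrightarrow>
      wlp c r (I (insert (i, j) X))"
    and final: "\<And>r. (\<And>z. z \<noteq> x \<Longrightarrow> z \<noteq> y \<Longrightarrow> z \<notin> assigned c \<Longrightarrow> r z = s z) \<Longrightarrow>
      I ({..<s n []} \<times> {..<s n []}) r \<Longrightarrow> Q r"
  shows "wlp (For x n (For y n c)) s Q"
proof (rule wlp_For[where I = "\<lambda>i. I ({..<i} \<times> {..<s n []})"])
  show "I ({..<0} \<times> {..<s n []}) (store s x [] 0)" using init stable by simp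
next
  fix i r
  assume i: "i < s n []" "r x [] = i" and I: "I ({..<i} \<times> {..<s n []}) r"
    and frame: "\<And>z. z \<noteq> x \<Longrightarrow> z \<notin> assigned (For y n c) \<Longrightarrow> r z = s z"
  have rn: "r n = s n" using frame vars by auto
  show "wlp (For y n c) r (\<lambda>r'. I ({..<Suc i} \<times> {..<s n []}) (store r' x [] (Suc i)))"
  proof (rule wlp_For[where I = "\<lambda>j. I ({..<i} \<times> {..<s n []} \<union> {i} \<times> {..<j})"])
    show "I ({..<i} \<times> {..<s n []} \<union> {i} \<times> {..<0}) (store r y [] 0)"
      using I stable by simp
  next
    fix j r'
    assume j: "j < r n []" "r' y [] = j" and I: "I ({..<i} \<times> {..<s n []} \<union> {i} \<times> {..<j}) r'"
      and frame': "\<And>z. z \<noteq> y \<Longrightarrow> z \<notin> assigned c \<Longrightarrow> r' z = r z"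
    have "r' x [] = i" using frame' vars i by auto
    then have "wlp c r' (I (insert (i, j) ({..<i} \<times> {..<s n []} \<union> {i} \<times> {..<j})))"
      using i j I frame frame' rn by (intro step) auto
    moreover have "insert (i, j) ({..<i} \<times> {..<s n []} \<union> {i} \<times> {..<j}) =
        {..<i} \<times> {..<s n []} \<union> {i} \<times> {..<Suc j}" by auto
    ultimately have "wlp c r' (I ({..<i} \<times> {..<s n []} \<union> {i} \<times> {..<Suc j}))" by simp
    then show "wlp c r' (\<lambda>r''. I ({..<i} \<times> {..<s n []} \<union> {i} \<times> {..<Suc j}) (store r'' y [] (Suc j)))"
      by (rule wlp_conseq) (use stable in blast)
  next
    fix r'
    assume "I ({..<i} \<times> {..<s n []} \<union> {i} \<times> {..<r n []}) r'"
    moreover have "{..<i} \<times> {..<s n []} \<union> {i} \<times> {..<r n []} = {..<Suc i} \<times> {..<s n []}"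
      using rn by auto
    ultimately show "I ({..<Suc i} \<times> {..<s n []}) (store r' x [] (Suc i))"
      using stable by simp
  qed (use vars in auto)
qed (use vars final in auto)

lemma wlp_For3:
  assumes vars: "distinct [x, y, w, n]" "{x, y, w, n} \<inter> assigned c = {}"
    and init: "I {} s"
    and stable: "\<And>X r z i. z \<in> {x, y, w} \<Longrightarrow> I X r \<Longrightarrow> I X (store r z [] i)"
    and step: "\<And>X i j l r. i < s n [] \<Longrightarrow> j < s n [] \<Longrightarrow> l < s n [] \<Longrightarrow>
      r x [] = i \<Longrightarrow> r y [] = j \<Longrightarrow> r w [] = l \<Longrightarrow>
      (\<And>z. z \<notin> {x, y, w} \<Longrightarrow> z \<notin> assigned c \<Longrightarrow> r z = s z) \<Longrightarrow> I X r \<Longrightarrow>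
      wlp c r (I (insert (i, j, l) X))"
    and final: "\<And>r. (\<And>z. z \<notin> {x, y, w} \<Longrightarrow> z \<notin> assigned c \<Longrightarrow> r z = s z) \<Longrightarrow>
      I ({..<s n []} \<times> {..<s n []} \<times> {..<s n []}) r \<Longrightarrow> Q r"
  shows "wlp (For x n (For y n (For w n c))) s Q"
proof (rule wlp_For2[where I = "\<lambda>X. I {(i, j, l). (i, j) \<in> X \<and> l < s n []}"])
  fix X :: "(nat \<times> nat) set" and i j r
  let ?Y = "{(i :: nat, j :: nat, l). (i, j) \<in> X \<and> l < s n []}"
  assume ij: "i < s n []" "j < s n []" "r x [] = i" "r y [] = j" and I: "I ?Y r"
    and frame: "\<And>z. z \<noteq> x \<Longrightarrow> z \<noteq> y \<Longrightarrow> z \<notin> assigned (For w n c) \<Longrightarrow> r z = s z"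
  have rn: "r n = s n" using frame vars by auto
  show "wlp (For w n c) r (I {(i', j', l). (i', j') \<in> insert (i, j) X \<and> l < s n []})"
  proof (rule wlp_For[where I = "\<lambda>m. I (?Y \<union> (\<lambda>l. (i, j, l)) ` {..<m})"])
    show "I (?Y \<union> (\<lambda>l. (i, j, l)) ` {..<0}) (store r w [] 0)"
      using I stable by simp
  next
    fix m r'
    assume m: "m < r n []" "r' w [] = m" and I: "I (?Y \<union> (\<lambda>l. (i, j, l)) ` {..<m}) r'"
      and frame': "\<And>z. z \<noteq> w \<Longrightarrow> z \<notin> assigned c \<Longrightarrow> r' z = r z"
    have "r' x [] = i" "r' y [] = j" using frame' vars ij by auto
    then have "wlp c r' (I (insert (i, j, m) (?Y \<union> (\<lambda>l. (i, j, l)) ` {..<m})))"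
      using ij m I frame frame' rn by (intro step) auto
    moreover have "insert (i, j, m) (?Y \<union> (\<lambda>l. (i, j, l)) ` {..<m}) =
        ?Y \<union> (\<lambda>l. (i, j, l)) ` {..<Suc m}" by (auto simp: less_Suc_eq)
    ultimately have "wlp c r' (I (?Y \<union> (\<lambda>l. (i, j, l)) ` {..<Suc m}))" by simp
    then show "wlp c r' (\<lambda>r''. I (?Y \<union> (\<lambda>l. (i, j, l)) ` {..<Suc m}) (store r'' w [] (Suc m)))"
      by (rule wlp_conseq) (use stable in blast)
  next
    fix r'
    assume "I (?Y \<union> (\<lambda>l. (i, j, l)) ` {..<r n []}) r'"
    moreover have "?Y \<union> (\<lambda>l. (i, j, l)) ` {..<r n []} =
        {(i', j', l). (i', j') \<in> insert (i, j) X \<and> l < s n []}"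
      using rn by auto
    ultimately show "I {(i', j', l). (i', j') \<in> insert (i, j) X \<and> l < s n []} r'" by simp
  qed (use vars in auto)
next
  fix r
  assume frame: "\<And>z. z \<noteq> x \<Longrightarrow> z \<noteq> y \<Longrightarrow> z \<notin> assigned (For w n c) \<Longrightarrow> r z = s z"
    and "I {(i, j, l). (i, j) \<in> {..<s n []} \<times> {..<s n []} \<and> l < s n []} r"
  moreover have "{(i, j, l). (i, j) \<in> {..<s n []} \<times> {..<s n []} \<and> l < s n []} =
      {..<s n []} \<times> {..<s n []} \<times> {..<s n []}" by auto
  ultimately show "Q r" using final by auto
next
  have empty: "{(i, j, l). (i, j) \<in> {} \<and> l < s n []} = ({} :: (nat \<times> nat \<times> nat) set)"
    by auto
  show "I {(i, j, l). (i, j) \<in> {} \<and> l < s n []} s" unfolding empty by (rule init)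
qed (use vars stable in auto)

section \<open>Computing a kernel\<close>

definition arcs_in :: "memory \<Rightarrow> nat rel" where
  "arcs_in s = {(u, w). u < s ''n'' [] \<and> w < s ''n'' [] \<and> s ''E'' [u, w] = 1}"

definition set_in :: "string \<Rightarrow> memory \<Rightarrow> nat set" where
  "set_in x s = {w. w < s ''n'' [] \<and> s x [w] = 1}"

lemma finite_set_in [simp]: "finite (set_in x s)"
  by (simp add: set_in_def)

lemma set_in_store [simp]: "''n'' \<noteq> x \<Longrightarrow> y \<noteq> x \<Longrightarrow> set_in y (store s x is i) = set_in y s"
  by (simp add: set_in_def)

lemma finite_arcs_in: "finite (arcs_in s)"
  by (rule finite_subset[of _ "{..<s ''n'' []} \<times> {..<s ''n'' []}"]) (auto simp: arcs_in_def)

lemma card_set_in: "card (set_in x s) \<le> s ''n'' []"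
  using card_mono[of "{..<s ''n'' []}" "set_in x s"] by (auto simp: set_in_def)

text \<open>The cell \<open>R [of_bool p, u, w]\<close> tells whether a walk of parity \<open>p\<close> from \<open>u\<close> to \<open>w\<close> inside
  the set \<open>A\<close> has been found.\<close>

abbreviation found :: "memory \<Rightarrow> bool \<Rightarrow> nat \<Rightarrow> nat \<Rightarrow> bool" where
  "found s p u w \<equiv> s ''R'' [of_bool p, u, w] = 1"

section \<open>The program for kernels\<close>

text \<open>Empty walks are entered at vertices of \<open>A\<close> only. Extensions then have to
  test just the head of the new arc for all walks to stay inside \<open>A\<close>.\<close>

definition init_walks :: com where
  "init_walks = For ''x'' ''n'' (For ''y'' ''n'' (Seq
     (Assign ''R'' [Num 1, Cell ''x'' [], Cell ''y'' []] (Num 0))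
     (If (Conj (Equal (Cell ''x'' []) (Cell ''y'' [])) (Equal (Cell ''A'' [Cell ''x'' []]) (Num 1)))
       (Assign ''R'' [Num 0, Cell ''x'' [], Cell ''y'' []] (Num 1))
       (Assign ''R'' [Num 0, Cell ''x'' [], Cell ''y'' []] (Num 0)))))"

text \<open>Layer \<open>p\<close> of \<open>R\<close> is read and only the other layer is written,
  so updating in place cannot influence later iterations of the same pass.\<close>

definition extend_walks :: "bool \<Rightarrow> com" where
  "extend_walks p = For ''x'' ''n'' (For ''y'' ''n'' (For ''w'' ''n'' (If
     (Conj (Equal (Cell ''R'' [Num (of_bool p), Cell ''x'' [], Cell ''y'' []]) (Num 1))
       (Conj (Equal (Cell ''E'' [Cell ''y'' [], Cell ''w'' []]) (Num 1))
         (Equal (Cell ''A'' [Cell ''w'' []]) (Num 1))))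
     (Assign ''R'' [Num (of_bool (\<not> p)), Cell ''x'' [], Cell ''w'' []] (Num 1))
     Skip)))"

text \<open>The parity cover of a digraph on \<open>n\<close> vertices has at most \<open>2 * n * n\<close> arcs, so that many
  extensions reach the transitive closure.\<close>

definition find_walks :: com where
  "find_walks = Seq init_walks (For ''a'' ''n'' (For ''b'' ''n''
     (Seq (Seq (extend_walks False) (extend_walks True))
       (Seq (extend_walks False) (extend_walks True)))))"

text \<open>\<open>z = n\<close> encodes that no vertex qualifies; otherwise \<open>z\<close> ends
  as the last vertex that does.\<close>

definition find_sink :: com where
  "find_sink = Seq (Assign ''z'' [] (Cell ''n'' [])) (For ''x'' ''n''
     (Seq (Assign ''ok'' [] (Cell ''A'' [Cell ''x'' []]))
     (Seq (For ''y'' ''n'' (If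
         (Conj (Disj (Equal (Cell ''R'' [Num 0, Cell ''x'' [], Cell ''y'' []]) (Num 1))
                 (Equal (Cell ''R'' [Num 1, Cell ''x'' [], Cell ''y'' []]) (Num 1)))
           (Neg (Disj (Equal (Cell ''R'' [Num 0, Cell ''y'' [], Cell ''x'' []]) (Num 1))
                 (Equal (Cell ''R'' [Num 1, Cell ''y'' [], Cell ''x'' []]) (Num 1)))))
         (Assign ''ok'' [] (Num 0)) Skip))
       (If (Equal (Cell ''ok'' []) (Num 1)) (Assign ''z'' [] (Cell ''x'' [])) Skip))))"

definition take_class :: com where
  "take_class = Seq
     (For ''w'' ''n'' (If (Equal (Cell ''R'' [Num 0, Cell ''z'' [], Cell ''w'' []]) (Num 1))
       (Assign ''K'' [Cell ''w'' []] (Num 1)) Skip))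
     (For ''w'' ''n'' (For ''y'' ''n'' (If
       (Conj (Equal (Cell ''K'' [Cell ''y'' []]) (Num 1))
         (Disj (Equal (Cell ''w'' []) (Cell ''y'' []))
           (Equal (Cell ''E'' [Cell ''w'' [], Cell ''y'' []]) (Num 1))))
       (Assign ''A'' [Cell ''w'' []] (Num 0)) Skip)))"

text \<open>\<open>K\<close> must be cleared because it still holds the kernel for the previous
  colour. \<open>n\<close> rounds suffice: while \<open>A\<close> is nonempty, each round deletes at
  least the sink vertex found.\<close>

definition find_kernel :: com where
  "find_kernel = Seq (For ''w'' ''n'' (Assign ''K'' [Cell ''w'' []] (Num 0)))
     (For ''r'' ''n'' (Seq find_walks (Seq find_sink
       (If (Less (Cell ''z'' []) (Cell ''n'' [])) take_class Skip))))"

lemma assigned_init_walks [simp]: "assigned init_walks = {''x'', ''y'', ''R''}"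
  by (auto simp: init_walks_def)

lemma assigned_extend_walks [simp]: "assigned (extend_walks p) = {''x'', ''y'', ''w'', ''R''}"
  by (auto simp: extend_walks_def)

lemma assigned_find_walks [simp]: "assigned find_walks = {''x'', ''y'', ''w'', ''R'', ''a'', ''b''}"
  by (auto simp: find_walks_def)

lemma assigned_find_sink [simp]: "assigned find_sink = {''z'', ''x'', ''ok'', ''y''}"
  by (auto simp: find_sink_def)

lemma assigned_take_class [simp]: "assigned take_class = {''w'', ''y'', ''K'', ''A''}"
  by (auto simp: take_class_def)

lemma assigned_find_kernel [simp]:
  "assigned find_kernel = {''w'', ''x'', ''y'', ''a'', ''b'', ''r'', ''z'', ''ok'', ''R'', ''K'', ''A''}"
  by (auto simp: find_kernel_def)

lemma polytime_find_walks: "polytime find_walks"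
  unfolding find_walks_def init_walks_def extend_walks_def
  by (intro polytime_Seq polytime_For polytime_If polytime_Assign polytime_Skip) auto

lemma polytime_find_sink: "polytime find_sink"
  unfolding find_sink_def
  by (intro polytime_Seq polytime_For polytime_If polytime_Assign polytime_Skip) auto

lemma polytime_take_class: "polytime take_class"
  unfolding take_class_def
  by (intro polytime_Seq polytime_For polytime_If polytime_Assign polytime_Skip) auto

lemma polytime_find_kernel: "polytime find_kernel"
  unfolding find_kernel_def
  by (intro polytime_Seq polytime_For polytime_If polytime_Assign polytime_Skip
      polytime_find_walks polytime_find_sink polytime_take_class) auto

section \<open>Correctness of the kernel program\<close>

lemma wlp_init_walks:
  "wlp init_walks s (\<lambda>s'. \<forall>p. \<forall>u < s ''n'' []. \<forall>w < s ''n'' [].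
     found s' p u w \<longleftrightarrow> \<not> p \<and> u = w \<and> u \<in> set_in ''A'' s)"
  unfolding init_walks_def
proof (rule wlp_For2[where I = "\<lambda>X r. \<forall>(u, w) \<in> X. r ''R'' [1, u, w] = 0 \<and>
     (r ''R'' [0, u, w] = (if u = w \<and> s ''A'' [u] = 1 then 1 else 0))"], goal_cases)
  case (5 X i j r)
  have "r ''A'' = s ''A''" by (rule 5(5)) simp_all
  then show ?case using 5(3,4,6) by auto
next
  case (6 r)
  show ?case
  proof (intro allI impI)
    fix p u w assume "u < s ''n'' []" "w < s ''n'' []"
    then show "found r p u w \<longleftrightarrow> \<not> p \<and> u = w \<and> u \<in> set_in ''A'' s"
      using 6(2) by (cases p) (auto simp: set_in_def split: if_splits)
  qed
qed auto

lemma wlp_extend_walks: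
  "wlp (extend_walks p) s (\<lambda>s'. \<forall>u < s ''n'' []. \<forall>w < s ''n'' [].
     (found s' p u w \<longleftrightarrow> found s p u w) \<and>
     (found s' (\<not> p) u w \<longleftrightarrow> found s (\<not> p) u w \<or>
       (\<exists>y < s ''n'' []. found s p u y \<and> (y, w) \<in> arcs_in s \<and> w \<in> set_in ''A'' s)))"
proof -
  let ?new = "\<lambda>X u w. \<exists>y. (u, y, w) \<in> X \<and> found s p u y \<and> s ''E'' [y, w] = 1 \<and> s ''A'' [w] = 1"
  show ?thesis
    unfolding extend_walks_def
  proof (rule wlp_For3[where I = "\<lambda>X r. \<forall>u w. (found r p u w \<longleftrightarrow> found s p u w) \<and>
      (found r (\<not> p) u w \<longleftrightarrow> found s (\<not> p) u w \<or> ?new X u w)"], goal_cases)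
    case (5 X i j l r)
    have "r ''E'' = s ''E''" "r ''A'' = s ''A''" by (rule 5(7); simp)+
    moreover have "[of_bool p, u, w] \<noteq> [of_bool (\<not> p), i, l]" for u w :: nat
      by simp
    ultimately show ?case using 5(4,5,6,8) by (auto 0 3)
  next
    case (6 r)
    then show ?case by (fastforce simp: arcs_in_def set_in_def)
  qed auto
qed

lemma card_parity_cover:
  assumes "finite E"
  shows "finite (parity_cover E)" "card (parity_cover E) \<le> 2 * card E"
proof -
  have eq: "parity_cover E = (\<lambda>((u, w), p). ((u, p), (w, \<not> p))) ` (E \<times> UNIV)"
    by (force simp: parity_cover_def)
  show "finite (parity_cover E)" unfolding eq using assms by simp
  have "card (parity_cover E) \<le> card (E \<times> (UNIV :: bool set))"
    unfolding eq using assms by (intro card_image_le) simp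
  then show "card (parity_cover E) \<le> 2 * card E" by (simp add: card_cartesian_product)
qed

lemma card_arcs_in: "card (Restr (arcs_in s) A) \<le> s ''n'' [] * s ''n'' []"
  using card_mono[of "{..<s ''n'' []} \<times> {..<s ''n'' []}" "Restr (arcs_in s) A"]
  by (auto simp: arcs_in_def card_cartesian_product)

abbreviation active_arcs :: "memory \<Rightarrow> nat rel" where
  "active_arcs s \<equiv> Restr (arcs_in s) (set_in ''A'' s)"

text \<open>Only completeness is limited to length \<open>j\<close>. Longer walks may be found
  early, since the pass for odd walks already sees what the pass for even walks has just
  added.\<close>

definition walks_upto :: "memory \<Rightarrow> nat \<Rightarrow> memory \<Rightarrow> bool" where
  "walks_upto s j r \<longleftrightarrow> r ''n'' = s ''n'' \<and> r ''E'' = s ''E'' \<and> r ''A'' = s ''A'' \<and>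
     (\<forall>p. \<forall>u < s ''n'' []. \<forall>w < s ''n'' []. found r p u w \<longrightarrow>
        u \<in> set_in ''A'' s \<and> parity_walk (active_arcs s) p u w) \<and>
     (\<forall>p. \<forall>u \<in> set_in ''A'' s. \<forall>w. \<forall>i \<le> j.
        ((u, False), (w, p)) \<in> parity_cover (active_arcs s) ^^ i \<longrightarrow> found r p u w)"

lemma walks_upto_store:
  assumes "x \<notin> {''n'', ''E'', ''A'', ''R''}"
  shows "walks_upto s j (store r x is i) = walks_upto s j r"
proof -
  have "store r x is i y = r y" if "y \<in> {''n'', ''E'', ''A'', ''R''}" for y
    by (rule store_other) (use assms that in blast)
  then show ?thesis unfolding walks_upto_def by simp
qed

lemma wlp_extend_walks_twice:
  assumes "walks_upto s j r"
  shows "wlp (Seq (extend_walks False) (extend_walks True)) r (walks_upto s (Suc j))"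
proof -
  let ?F = "active_arcs s"
  have frame: "r ''n'' = s ''n''" "r ''E'' = s ''E''" "r ''A'' = s ''A''"
    using assms unfolding walks_upto_def by blast+
  have sets: "set_in ''A'' r = set_in ''A'' s" "arcs_in r = arcs_in s" "r ''n'' = s ''n''"
    unfolding set_in_def arcs_in_def frame by (rule refl)+
  have sound: "\<And>p u w. u < s ''n'' [] \<Longrightarrow> w < s ''n'' [] \<Longrightarrow> found r p u w \<Longrightarrow>
        u \<in> set_in ''A'' s \<and> parity_walk ?F p u w"
    and complete: "\<And>p u w i. u \<in> set_in ''A'' s \<Longrightarrow> i \<le> j \<Longrightarrow>
        ((u, False), (w, p)) \<in> parity_cover ?F ^^ i \<Longrightarrow> found r p u w"
    using assms unfolding walks_upto_def by blast+
  let ?ext = "\<lambda>p r r1. \<forall>u < s ''n'' []. \<forall>w < s ''n'' [].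
     (found r1 p u w \<longleftrightarrow> found r p u w) \<and>
     (found r1 (\<not> p) u w \<longleftrightarrow> found r (\<not> p) u w \<or>
       (\<exists>y < s ''n'' []. found r p u y \<and> (y, w) \<in> arcs_in s \<and> w \<in> set_in ''A'' s))"
  have "walks_upto s (Suc j) r2"
    if "?ext False r r1" "?ext True r1 r2" "r2 ''E'' = s ''E''" "r2 ''A'' = s ''A''"
      "r2 ''n'' = s ''n''" for r1 r2
  proof -
    have sound_ext: "u \<in> set_in ''A'' s \<and> parity_walk ?F (\<not> p) u w"
      if "u \<in> set_in ''A'' s \<and> parity_walk ?F p u y" "(y, w) \<in> arcs_in s" "w \<in> set_in ''A'' s"
      for p u y w
    proof -
      have "y \<in> set_in ''A'' s" using that parity_walk_Restr_mem by fast
      then show ?thesis using that parity_walk_step[of ?F p u y w] by blast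
    qed
    \<comment> \<open>Soundness of a single pass for either parity, applied to both passes
      below.\<close>
    have ext_sound: "u \<in> set_in ''A'' s \<and> parity_walk ?F q u w"
      if S: "\<And>q u w. u < s ''n'' [] \<Longrightarrow> w < s ''n'' [] \<Longrightarrow> found t q u w \<Longrightarrow>
          u \<in> set_in ''A'' s \<and> parity_walk ?F q u w"
        and X: "?ext p t t1" and lt: "u < s ''n'' []" "w < s ''n'' []" and q: "found t1 q u w"
      for t p t1 u w q
    proof (cases "q = p")
      case True
      then show ?thesis using X S[OF lt] lt q by blast
    next
      case False
      then have np: "q = (\<not> p)" by simp
      then consider "found t q u w" | y where "y < s ''n'' []" "found t p u y"
        "(y, w) \<in> arcs_in s" "w \<in> set_in ''A'' s"
        using X lt q by blast
      then show ?thesis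
      proof cases
        case 1
        then show ?thesis by (rule S[OF lt])
      next
        case (2 y)
        then show ?thesis unfolding np using S[OF lt(1)] by (intro sound_ext) blast+
      qed
    qed
    have sound1: "u \<in> set_in ''A'' s \<and> parity_walk ?F q u w"
      if "u < s ''n'' []" "w < s ''n'' []" "found r1 q u w" for q u w
      using ext_sound[of r r1 False u w q] sound \<open>?ext False r r1\<close> that by blast
    have sound2: "u \<in> set_in ''A'' s \<and> parity_walk ?F q u w"
      if "u < s ''n'' []" "w < s ''n'' []" "found r2 q u w" for q u w
      using ext_sound[of r1 r2 True u w q] sound1 \<open>?ext True r1 r2\<close> that by blast
    have grow: "found r2 p u w" if "u < s ''n'' []" "w < s ''n'' []" "found r p u w" for p u w
      using that \<open>?ext False r r1\<close> \<open>?ext True r1 r2\<close> by (cases p) auto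
    have complete2: "found r2 p u w"
      if u: "u \<in> set_in ''A'' s" and i: "i \<le> Suc j"
        and walk: "((u, False), (w, p)) \<in> parity_cover ?F ^^ i" for p u w i
    proof (cases i)
      case 0
      then have "found r p u w" using complete[OF u _ walk] by simp
      moreover have "w = u" using 0 walk by simp
      ultimately show ?thesis using u grow by (auto simp: set_in_def)
    next
      case (Suc i')
      then obtain y q where y: "((u, False), (y, q)) \<in> parity_cover ?F ^^ i'"
        "((y, q), (w, p)) \<in> parity_cover ?F" using walk by auto
      then have q: "q = (\<not> p)" and yw: "(y, w) \<in> ?F" by (auto simp: parity_cover_def)
      have lt: "u < s ''n'' []" "y < s ''n'' []" "w < s ''n'' []"
        using u yw by (auto simp: set_in_def)
      \<comment> \<open>Without its last arc the walk has at most \<open>j\<close> arcs, so it was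
        known before; whichever pass reads its parity appends the last arc.\<close>
      have "found r (\<not> p) u y" using complete[OF u _ y(1)] i Suc q by simp
      then show ?thesis
        using \<open>?ext False r r1\<close> \<open>?ext True r1 r2\<close> lt yw by (cases p) auto
    qed
    show ?thesis unfolding walks_upto_def using that(3-5) sound2 complete2 by blast
  qed
  note final = this
  show ?thesis
    unfolding wlp_Seq
  proof (rule wlp_conseq[OF wlp_extend_walks], goal_cases)
    case r1: (1 r1)
    have sets1: "set_in ''A'' r1 = set_in ''A'' s" "arcs_in r1 = arcs_in s" "r1 ''n'' = s ''n''"
      using r1(2) frame sets(3) by (simp_all add: set_in_def arcs_in_def)
    show ?case
    proof (rule wlp_conseq[OF wlp_extend_walks], goal_cases)
      case r2: (1 r2)
      show ?case
      proof (rule final)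
        show "?ext False r r1" using r1(1) sets by simp
        show "?ext True r1 r2" using r2(1) sets1 by simp
      qed (use r1(2) r2(2) sets sets1 frame in simp_all)
    qed
  qed
qed

text \<open>In a finite relation, reachability is witnessed by a path with no more steps than the
  relation has pairs. The double cover has at most \<open>2 * n * n\<close> pairs, and the
  \<open>n * n\<close> iterations perform two rounds of extension each.\<close>

lemma wlp_find_walks:
  "wlp find_walks s (\<lambda>s'. \<forall>p. \<forall>u < s ''n'' []. \<forall>w < s ''n'' [].
     found s' p u w \<longleftrightarrow> u \<in> set_in ''A'' s \<and> parity_walk (active_arcs s) p u w)"
proof -
  let ?n = "s ''n'' []"
  let ?F = "active_arcs s"
  let ?body = "Seq (Seq (extend_walks False) (extend_walks True))
       (Seq (extend_walks False) (extend_walks True))"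
  have body: "wlp ?body r (walks_upto s (2 * Suc j))" if "walks_upto s (2 * j) r" for r j
    unfolding wlp_Seq[of "Seq _ _"]
    by (rule wlp_conseq[OF wlp_extend_walks_twice[OF that]])
      (use wlp_extend_walks_twice[of s "Suc (2 * j)"] in simp)
  show ?thesis
    unfolding find_walks_def wlp_Seq
  proof (rule wlp_conseq[OF wlp_init_walks], goal_cases)
    case (1 s1)
    have init: "walks_upto s 0 s1"
      unfolding walks_upto_def
    proof (intro conjI allI ballI impI)
      fix u w p i
      assume u: "u \<in> set_in ''A'' s" and "i \<le> (0 :: nat)"
        and "((u, False), (w, p)) \<in> parity_cover ?F ^^ i"
      then have "w = u" "p = False" by simp_all
      moreover have "u < ?n" using u by (simp add: set_in_def)
      ultimately show "found s1 p u w" using 1(1) u by blast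
    qed (use 1 parity_walk_refl in \<open>auto simp: parity_walk_refl\<close>)
    have n: "s1 ''n'' = s ''n''" using 1 by simp
    show ?case
    proof (rule wlp_For[where I = "\<lambda>a. walks_upto s (2 * (a * ?n))"], goal_cases)
      case outer: (5 a r)
      then have n: "r ''n'' = s ''n''" using \<open>s1 ''n'' = s ''n''\<close> by simp
      show ?case
      proof (rule wlp_For[where I = "\<lambda>b. walks_upto s (2 * (a * ?n + b))"], goal_cases)
        case (5 b r')
        then have "wlp ?body r' (walks_upto s (2 * Suc (a * ?n + b)))" by (intro body) blast
        then show ?case by (rule wlp_conseq) (simp add: walks_upto_store)
      next
        case (6 r')
        then show ?case using n by (simp add: walks_upto_store add.commute)
      qed (use outer in \<open>auto simp: walks_upto_store\<close>)
    next
      case (6 r)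
      have fin: "finite ?F" using finite_arcs_in by auto
      have "card (parity_cover ?F) \<le> 2 * (?n * ?n)"
        using card_parity_cover(2)[OF fin] card_arcs_in[of s "set_in ''A'' s"] by linarith
      then have walk: "\<exists>i \<le> 2 * (?n * ?n). ((u, False), (w, p)) \<in> parity_cover ?F ^^ i"
        if walk: "parity_walk ?F p u w" for p u w
      proof -
        obtain i where "i \<le> card (parity_cover ?F)" "((u, False), (w, p)) \<in> parity_cover ?F ^^ i"
          using walk unfolding parity_walk_def rtrancl_finite_eq_relpow[OF card_parity_cover(1)[OF fin]]
          by blast
        then show ?thesis using \<open>card (parity_cover ?F) \<le> 2 * (?n * ?n)\<close> le_trans by blast
      qed
      have "walks_upto s (2 * (?n * ?n)) r" using 6(2) unfolding n .
      then show ?case unfolding walks_upto_def using walk by blast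
    qed (use init in \<open>auto simp: walks_upto_store\<close>)
  qed
qed

text \<open>Stated purely about the table \<open>R\<close>; only in \<open>wlp_find_kernel\<close>,
  where the table is known to be exact, does this become \<open>sink_vertex\<close>.\<close>

lemma wlp_find_sink:
  "wlp find_sink s (\<lambda>s'.
     (s' ''z'' [] < s ''n'' [] \<longrightarrow> s' ''z'' [] \<in> {x. s ''A'' [x] = 1 \<and> (\<forall>y < s ''n'' [].
        (\<exists>p. found s p x y) \<longrightarrow> (\<exists>p. found s p y x))}) \<and>
     (\<not> s' ''z'' [] < s ''n'' [] \<longrightarrow> (\<forall>x < s ''n'' []. x \<notin> {x. s ''A'' [x] = 1 \<and> (\<forall>y < s ''n'' [].
        (\<exists>p. found s p x y) \<longrightarrow> (\<exists>p. found s p y x))})))"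
proof -
  let ?n = "s ''n'' []"
  define good where "good = {x. s ''A'' [x] = 1 \<and> (\<forall>y < ?n.
        (\<exists>p. found s p x y) \<longrightarrow> (\<exists>p. found s p y x))}"
  show ?thesis
    unfolding find_sink_def wlp_Seq wlp_Assign good_def[symmetric]
  proof (rule wlp_For[where I = "\<lambda>i r. if r ''z'' [] < ?n then r ''z'' [] \<in> good
      else \<forall>x < i. x \<notin> good"], goal_cases)
    case (5 i r)
    then have frame: "r ''n'' = s ''n''" "r ''A'' = s ''A''" "r ''R'' = s ''R''" by simp_all
    have i: "i < ?n" "r ''x'' [] = i" using 5 by simp_all
    have I: "if r ''z'' [] < ?n then r ''z'' [] \<in> good else \<forall>x < i. x \<notin> good" by (rule 5)
    show ?case
      unfolding wlp_Seq wlp_Assign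
    proof (rule wlp_For[where I = "\<lambda>j r. r ''ok'' [] = (if \<forall>y < j.
        (\<exists>p. found s p i y) \<longrightarrow> (\<exists>p. found s p y i) then s ''A'' [i] else 0)"], goal_cases)
      case (5 j r')
      then have "r' ''R'' = s ''R''" "r' ''x'' [] = i" using frame i by simp_all
      then show ?case using 5(2,4) by (auto simp: less_Suc_eq ex_bool_eq)
    next
      case (6 r')
      then have r': "r' ''x'' [] = i" "r' ''z'' = r ''z''" using i by simp_all
      have "r' ''ok'' [] = 1 \<longleftrightarrow> i \<in> good"
        using 6(2) frame(1) by (simp add: good_def)
      then show ?case using r' I i(1)
        by (cases "r ''z'' [] < ?n"; cases "i \<in> good") (simp_all add: less_Suc_eq)
    qed (use frame i in auto)
  qed auto
qed

lemma wlp_take_class: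
  assumes z: "s ''z'' [] < s ''n'' []"
  shows "wlp take_class s (\<lambda>s'.
     set_in ''K'' s' = set_in ''K'' s \<union> {w. w < s ''n'' [] \<and> found s False (s ''z'' []) w} \<and>
     set_in ''A'' s' = set_in ''A'' s - set_in ''K'' s' - (arcs_in s)\<inverse> `` set_in ''K'' s')"
  unfolding take_class_def wlp_Seq
proof (rule wlp_For[where I = "\<lambda>i r. \<forall>w. r ''K'' [w] = (if w < i \<and> found s False (s ''z'' []) w then 1
    else s ''K'' [w])"], goal_cases)
  case (5 i r)
  then have "r ''z'' = s ''z''" "r ''R'' = s ''R''" by simp_all
  then show ?case using 5(2,4) by (auto simp: less_Suc_eq)
next
  case (6 s1)
  then have frame: "s1 ''n'' = s ''n''" "s1 ''E'' = s ''E''" "s1 ''A'' = s ''A''" by simp_all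
  have K: "set_in ''K'' s1 = set_in ''K'' s \<union> {w. w < s ''n'' [] \<and> found s False (s ''z'' []) w}"
    using 6(2) frame by (auto simp: set_in_def)
  show ?case
  proof (rule wlp_For2[where I = "\<lambda>X r. \<forall>w. r ''A'' [w] =
      (if \<exists>y. (w, y) \<in> X \<and> s1 ''K'' [y] = 1 \<and> (w = y \<or> s ''E'' [w, y] = 1) then 0
       else s ''A'' [w])"], goal_cases)
    case (5 X i j r)
    then have "r ''K'' = s1 ''K''" "r ''E'' = s ''E''" using frame by simp_all
    then show ?case using 5(3,4,6) by auto
  next
    case (6 r)
    then have n: "r ''n'' = s ''n''" "r ''K'' = s1 ''K''" using frame by simp_all
    then have Kr: "set_in ''K'' r = set_in ''K'' s1" using frame by (simp add: set_in_def)
    have "set_in ''A'' r = set_in ''A'' s - set_in ''K'' s1 - (arcs_in s)\<inverse> `` set_in ''K'' s1"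
      using 6(2) n frame by (auto simp: set_in_def arcs_in_def split: if_splits)
    then show ?case using K Kr by simp
  qed (use frame in auto)
qed auto

lemma wlp_find_kernel:
  assumes free: "odd_closed_free (arcs_in s)"
  shows "wlp find_kernel s (\<lambda>s'. kernel (arcs_in s) (set_in ''A'' s) (set_in ''K'' s'))"
proof -
  let ?n = "s ''n'' []" and ?E = "arcs_in s" and ?B = "set_in ''A'' s"
  \<comment> \<open>The bound on the cardinality makes \<open>A\<close> empty after \<open>n\<close>
    rounds, when the partial kernel is a kernel.\<close>
  let ?inv = "\<lambda>i r. r ''n'' = s ''n'' \<and> r ''E'' = s ''E'' \<and>
    partial_kernel ?E ?B (set_in ''A'' r) (set_in ''K'' r) \<and> card (set_in ''A'' r) \<le> ?n - i"
  have round: "wlp (Seq find_walks (Seq find_sink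
      (If (Less (Cell ''z'' []) (Cell ''n'' [])) take_class Skip))) r (?inv (Suc i))"
    if r: "?inv i r" for i r
  proof -
    let ?A = "set_in ''A'' r" and ?K = "set_in ''K'' r"
    have E: "arcs_in r = ?E" and n: "r ''n'' = s ''n''" using r by (auto simp: arcs_in_def)
    have pk: "partial_kernel ?E ?B ?A ?K" using r by blast
    show ?thesis
      unfolding wlp_Seq
    proof (rule wlp_conseq[OF wlp_find_walks], goal_cases)
      case (1 r1)
      have r1: "r1 ''n'' = s ''n''" "r1 ''E'' = s ''E''" "r1 ''A'' = r ''A''" "r1 ''K'' = r ''K''"
        using 1(2) r by simp_all
      have found: "found r1 p u w \<longleftrightarrow> u \<in> ?A \<and> parity_walk (Restr ?E ?A) p u w"
        if "u < ?n" "w < ?n" for p u w using 1(1) that E n by simp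
      have sink: "x \<in> {x. r1 ''A'' [x] = 1 \<and> (\<forall>y < r1 ''n'' [].
          (\<exists>p. found r1 p x y) \<longrightarrow> (\<exists>p. found r1 p y x))} \<longleftrightarrow> sink_vertex ?E ?A x"
        if "x < ?n" for x
      proof -
        have A: "r1 ''A'' [x] = 1 \<longleftrightarrow> x \<in> ?A" using that r1 n by (simp add: set_in_def)
        \<comment> \<open>The program inspects only vertices below \<open>n\<close>; this loses
          nothing, as walks starting in \<open>A\<close> stay in \<open>A\<close>.\<close>
        have mem: "w < ?n \<and> w \<in> ?A" if "x \<in> ?A" "parity_walk (Restr ?E ?A) p x w" for p w
          using parity_walk_Restr_mem[OF that(2,1)] n by (simp add: set_in_def)
        show ?thesis
          using A mem found that r1(1) unfolding sink_vertex_def mem_Collect_eq by metis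
      qed
      show ?case
      proof (rule wlp_conseq[OF wlp_find_sink], goal_cases)
        case (1 r2)
        have r2: "r2 ''n'' = s ''n''" "r2 ''E'' = s ''E''" "r2 ''A'' = r ''A''" "r2 ''K'' = r ''K''"
          "r2 ''R'' = r1 ''R''"
          using 1(2) r1 by simp_all
        have sets2: "set_in ''A'' r2 = ?A" "set_in ''K'' r2 = ?K" "arcs_in r2 = ?E"
          using r2 n by (simp_all add: set_in_def arcs_in_def)
        let ?z = "r2 ''z'' []"
        show ?case
        proof (cases "?z < ?n")
          case True
          have z: "sink_vertex ?E ?A ?z" using 1(1) sink[OF True] True r1(1) by simp
          have even: "{w. w < ?n \<and> found r2 False ?z w} = even_reach ?E ?A ?z"
          proof -
            have zA: "?z \<in> ?A" using z by (simp add: sink_vertex_def)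
            have "found r2 False ?z w \<longleftrightarrow> parity_walk (Restr ?E ?A) False ?z w" if "w < ?n" for w
              using found[OF True that, of False] zA r2(5) by simp
            moreover have "w < ?n" if "parity_walk (Restr ?E ?A) False ?z w" for w
              using parity_walk_Restr_mem[OF that zA] n by (simp add: set_in_def)
            ultimately show ?thesis unfolding even_reach_def by blast
          qed
          have "wlp take_class r2 (?inv (Suc i))"
          proof (rule wlp_conseq[OF wlp_take_class], goal_cases)
            case 1
            show ?case using True r2 by simp
          next
            case (2 r3)
            have K3: "set_in ''K'' r3 = ?K \<union> even_reach ?E ?A ?z"
              and A3: "set_in ''A'' r3 = ?A - set_in ''K'' r3 - ?E\<inverse> `` set_in ''K'' r3"
              using 2(1) r2(1) even sets2 by simp_all
            have pk3: "partial_kernel ?E ?B (set_in ''A'' r3) (set_in ''K'' r3)"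
              by (rule partial_kernel_step[OF free pk z K3 A3])
            have "set_in ''A'' r3 \<subset> ?A"
              using sink_vertex_in_even_reach[OF z] unfolding A3 K3 by blast
            then have "card (set_in ''A'' r3) < card ?A" by (intro psubset_card_mono) simp_all
            moreover have "card ?A \<le> ?n - i" using r by blast
            ultimately have "card (set_in ''A'' r3) \<le> ?n - Suc i" by linarith
            then show ?case using pk3 2(2) r2 by simp
          qed
          then show ?thesis using True r2 by simp
        next
          case False
          have none: "\<forall>x < ?n. x \<notin> {x. r1 ''A'' [x] = 1 \<and> (\<forall>y < r1 ''n'' [].
              (\<exists>p. found r1 p x y) \<longrightarrow> (\<exists>p. found r1 p y x))}"
            using 1(1)[THEN conjunct2, THEN mp, unfolded r1(1), OF False] unfolding r1(1) .
          have "\<not> sink_vertex ?E ?A x" for x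
          proof (cases "x < ?n")
            case True
            then show ?thesis using none sink by blast
          next
            case False
            then show ?thesis using n by (simp add: sink_vertex_def set_in_def)
          qed
          \<comment> \<open>A failed search means that every vertex is decided, so an idle round
            keeps the invariant.\<close>
          then have "?A = {}" using sink_vertex_exists[OF finite_set_in[of "''A''" r], of ?E] by metis
          then show ?thesis using False r2 sets2 pk by simp
        qed
      qed
    qed
  qed
  show ?thesis
    unfolding find_kernel_def wlp_Seq
  proof (rule wlp_For[where I = "\<lambda>i r. \<forall>w < i. r ''K'' [w] = 0"], goal_cases)
    case (6 s1)
    have s1: "s1 ''n'' = s ''n''" "s1 ''E'' = s ''E''" "s1 ''A'' = s ''A''" using 6(1) by simp_all
    have "set_in ''K'' s1 = {}" "set_in ''A'' s1 = ?B"
      using 6(2) s1 by (auto simp: set_in_def)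
    then have init: "?inv 0 s1" using s1 partial_kernel_initial card_set_in by simp
    show ?case
    proof (rule wlp_For[where I = ?inv], goal_cases)
      case 4
      show ?case using init by simp
    next
      case (5 i r)
      have "wlp (Seq find_walks (Seq find_sink
        (If (Less (Cell ''z'' []) (Cell ''n'' [])) take_class Skip))) r (?inv (Suc i))"
        by (rule round) (use 5 in blast)
      then show ?case by (rule wlp_conseq) simp
    next
      case (6 r)
      then have "set_in ''A'' r = {}" using s1 by simp
      then show ?case using 6 kernel_if_partial_kernel by metis
    qed simp_all
  qed (auto simp: less_Suc_eq)
qed

section \<open>Processing all colours\<close>

text \<open>The row \<open>v\<close> of \<open>S\<close> consists of one block of \<open>k\<close> colours for \<open>v\<close> itself and one for each
  out-neighbour of \<open>v\<close>, so its length \<open>k * (outdegree + 1)\<close> is obtained without multiplying.\<close>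

definition each_entry :: "com \<Rightarrow> com" where
  "each_entry c = For ''v'' ''n'' (Seq (Assign ''pos'' [] (Num 0)) (For ''u'' ''n'' (If
     (Disj (Equal (Cell ''u'' []) (Cell ''v'' []))
       (Equal (Cell ''E'' [Cell ''v'' [], Cell ''u'' []]) (Num 1)))
     (For ''i'' ''k'' (Seq (Assign ''col'' [] (Cell ''S'' [Cell ''v'' [], Cell ''pos'' []]))
       (Seq c (Assign ''pos'' [] (Plus (Cell ''pos'' []) (Num 1))))))
     Skip)))"

text \<open>The table \<open>M\<close> is indexed by the colour itself, so testing and deleting a
  colour is one access however large the colour is.\<close>

definition mark_colour :: com where
  "mark_colour = Assign ''M'' [Cell ''v'' [], Cell ''col'' []] (Num 1)"

definition find_active :: com where
  "find_active = For ''w'' ''n'' (If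
     (Conj (Equal (Cell ''M'' [Cell ''w'' [], Cell ''col'' []]) (Num 1))
       (Less (Num 0) (Cell ''Q'' [Cell ''w'' []])))
     (Assign ''A'' [Cell ''w'' []] (Num 1)) (Assign ''A'' [Cell ''w'' []] (Num 0)))"

text \<open>The first free slot in row \<open>w\<close> of \<open>C\<close> has index
  \<open>k\<close> minus the demand, so no separate fill counter is kept. It is computed before the
  demand drops.\<close>

definition give_colour :: com where
  "give_colour = For ''w'' ''n'' (Seq
     (If (Equal (Cell ''K'' [Cell ''w'' []]) (Num 1))
       (Seq
         (Assign ''C'' [Cell ''w'' [], Minus (Cell ''k'' []) (Cell ''Q'' [Cell ''w'' []])] (Cell ''col'' []))
         (Assign ''Q'' [Cell ''w'' []] (Minus (Cell ''Q'' [Cell ''w'' []]) (Num 1))))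
       Skip)
     (Assign ''M'' [Cell ''w'' [], Cell ''col'' []] (Num 0)))"

definition process_colour :: com where
  "process_colour = Seq find_active (Seq find_kernel give_colour)"

text \<open>Colours are enumerated through the entries of \<open>S\<close>. One that occurs
  repeatedly does no harm: after its first treatment it is in no list, so the active set and its
  kernel are empty.\<close>

definition choose_colours :: com where
  "choose_colours = Seq (For ''w'' ''n'' (Assign ''Q'' [Cell ''w'' []] (Cell ''k'' [])))
     (Seq (each_entry mark_colour) (each_entry process_colour))"

lemma assigned_each_entry [simp]:
  "assigned (each_entry c) = {''v'', ''u'', ''i'', ''pos'', ''col''} \<union> assigned c"
  by (auto simp: each_entry_def)

lemma assigned_mark_colour [simp]: "assigned mark_colour = {''M''}"
  by (simp add: mark_colour_def)

lemma assigned_find_active [simp]: "assigned find_active = {''w'', ''A''}"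
  by (auto simp: find_active_def)

lemma assigned_give_colour [simp]: "assigned give_colour = {''w'', ''C'', ''Q'', ''M''}"
  by (auto simp: give_colour_def)

lemma assigned_process_colour [simp]: "assigned process_colour =
  {''w'', ''x'', ''y'', ''a'', ''b'', ''r'', ''z'', ''ok'', ''R'', ''K'', ''A'', ''C'', ''Q'', ''M''}"
  by (auto simp: process_colour_def)

lemma polytime_each_entry:
  assumes "polytime c" "{''v'', ''u'', ''i'', ''n'', ''k''} \<inter> assigned c = {}"
  shows "polytime (each_entry c)"
  unfolding each_entry_def
  by (intro polytime_Seq polytime_For polytime_If polytime_Assign polytime_Skip assms(1))
    (use assms(2) in auto)

lemma polytime_choose_colours: "polytime choose_colours"
  unfolding choose_colours_def process_colour_def mark_colour_def find_active_def give_colour_def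
  by (intro polytime_Seq polytime_For polytime_If polytime_Assign polytime_Skip polytime_each_entry
      polytime_find_kernel) auto

text \<open>The position reached in row \<open>v\<close> when all \<open>u\<close> below
  \<open>m\<close> have had their blocks; it is the value of \<open>pos\<close> in the
  invariant.\<close>

definition row_length :: "memory \<Rightarrow> nat \<Rightarrow> nat \<Rightarrow> nat" where
  "row_length s v m = s ''k'' [] * card {u. u < m \<and> (u = v \<or> s ''E'' [v, u] = 1)}"

lemma row_length_0 [simp]: "row_length s v 0 = 0"
  by (simp add: row_length_def)

lemma row_length_Suc: "row_length s v (Suc m) =
  row_length s v m + (if m = v \<or> s ''E'' [v, m] = 1 then s ''k'' [] else 0)"
proof -
  have "{u. u < Suc m \<and> (u = v \<or> s ''E'' [v, u] = 1)} =
    (if m = v \<or> s ''E'' [v, m] = 1 then insert m else id) {u. u < m \<and> (u = v \<or> s ''E'' [v, u] = 1)}"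
    by (auto simp: less_Suc_eq)
  then show ?thesis by (simp add: row_length_def)
qed

lemma row_length_mono: "m \<le> m' \<Longrightarrow> row_length s v m \<le> row_length s v m'"
  unfolding row_length_def by (intro mult_le_mono2 card_mono) auto

definition row :: "memory \<Rightarrow> nat \<Rightarrow> nat \<Rightarrow> (nat \<times> nat) set" where
  "row s v m = (\<lambda>j. (v, s ''S'' [v, j])) ` {..<m}"

definition entries :: "memory \<Rightarrow> (nat \<times> nat) set" where
  "entries s = (\<Union>v < s ''n'' []. row s v (row_length s v (s ''n'' [])))"

lemma row_0 [simp]: "row s v 0 = {}"
  and row_Suc: "row s v (Suc m) = insert (v, s ''S'' [v, m]) (row s v m)"
  by (auto simp: row_def less_Suc_eq)

text \<open>The invariant is indexed by the set of vertex-colour pairs visited so far, which hides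
  blocks and positions from its uses.\<close>

lemma wlp_each_entry:
  assumes vars: "{''v'', ''u'', ''i'', ''pos'', ''col'', ''n'', ''k'', ''E'', ''S''} \<inter> assigned c = {}"
    and init: "J {} s"
    and stable: "\<And>X r x i. x \<in> {''v'', ''u'', ''i'', ''pos'', ''col''} \<Longrightarrow> J X r \<Longrightarrow>
      J X (store r x [] i)"
    and step: "\<And>X r. (r ''v'' [], r ''col'' []) \<in> entries s \<Longrightarrow>
      (\<And>z. z \<notin> {''v'', ''u'', ''i'', ''pos'', ''col''} \<Longrightarrow> z \<notin> assigned c \<Longrightarrow> r z = s z) \<Longrightarrow>
      J X r \<Longrightarrow> wlp c r (J (insert (r ''v'' [], r ''col'' []) X))"
  shows "wlp (each_entry c) s (J (entries s))"
proof -
  let ?n = "s ''n'' []"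
  let ?done = "\<lambda>v. \<Union>v' < v. row s v' (row_length s v' ?n)"
  show ?thesis
    unfolding each_entry_def
  proof (rule wlp_For[where I = "\<lambda>v. J (?done v)"], goal_cases)
    case v: (5 v r)
    have J0: "J (?done v) r" by (rule v(4))
    have r: "r ''v'' [] = v" "r ''n'' = s ''n''" "v < ?n" using v vars by auto
    show ?case
      unfolding wlp_Seq wlp_Assign
    proof (rule wlp_For[where I = "\<lambda>u r. r ''pos'' [] = row_length s v u \<and>
        J (?done v \<union> row s v (row_length s v u)) r"], goal_cases)
      case 4
      show ?case using J0 stable by simp
    next
      case u: (5 u r1)
      have r1: "r1 ''v'' [] = v" "r1 ''u'' [] = u" "r1 ''k'' = s ''k''" "r1 ''E'' = s ''E''" "u < ?n"
        using v(3) u vars r by auto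
      show ?case
      proof (cases "u = v \<or> s ''E'' [v, u] = 1")
        case True
        then have len: "row_length s v (Suc u) = row_length s v u + s ''k'' []"
          by (simp add: row_length_Suc)
        have "wlp (For ''i'' ''k'' (Seq (Assign ''col'' [] (Cell ''S'' [Cell ''v'' [], Cell ''pos'' []]))
            (Seq c (Assign ''pos'' [] (Plus (Cell ''pos'' []) (Num 1)))))) r1
          (\<lambda>r. r ''pos'' [] = row_length s v (Suc u) \<and>
             J (?done v \<union> row s v (row_length s v (Suc u))) r)"
        proof (rule wlp_For[where I = "\<lambda>i r. r ''pos'' [] = row_length s v u + i \<and>
            J (?done v \<union> row s v (row_length s v u + i)) r"], goal_cases)
          case 4
          show ?case using u(4) stable by simp
        next
          case i: (5 i r2)
          let ?j = "row_length s v u + i" and ?X = "?done v \<union> row s v (row_length s v u + i)"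
          have r2: "r2 ''v'' [] = v" "r2 ''pos'' [] = ?j" "r2 ''S'' = s ''S''"
            using v(3) u(3) i vars r1 by auto
          have "?j < row_length s v (Suc u)" using i(1) r1(3) len by simp
          also have "\<dots> \<le> row_length s v ?n" using r1(5) by (intro row_length_mono) simp
          finally have entry: "(v, s ''S'' [v, ?j]) \<in> entries s"
            using r(3) unfolding entries_def row_def by blast
          let ?r = "store r2 ''col'' [] (s ''S'' [v, ?j])"
          have frame: "?r z = s z"
            if "z \<notin> {''v'', ''u'', ''i'', ''pos'', ''col''}" "z \<notin> assigned c" for z
            using v(3)[of z] u(3)[of z] i(3)[of z] that by auto
          have "wlp c ?r (J (insert (?r ''v'' [], ?r ''col'' []) ?X))"
            using entry r2 i(4) stable frame by (intro step) auto
          then have "wlp c ?r (J (?done v \<union> row s v (Suc ?j)))"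
            using r2(1) by (simp add: row_Suc)
          then have "wlp c ?r (\<lambda>r'. r' ''pos'' [] = ?j \<and> J (?done v \<union> row s v (Suc ?j)) r')"
            by (rule wlp_conseq) (use vars r2(2) in auto)
          then show ?case
            unfolding wlp_Seq wlp_Assign using r2
            by (auto intro!: stable elim!: wlp_conseq)
        next
          case (6 r2)
          then show ?case using r1(3) len by simp
        qed (use vars in auto)
        then show ?thesis
          using True r1 by (auto intro!: stable elim!: wlp_conseq)
      next
        case False
        then show ?thesis using r1 u(4) stable by (auto simp: row_length_Suc)
      qed
    next
      case (6 r1)
      have "?done (Suc v) = ?done v \<union> row s v (row_length s v ?n)"
        by (auto simp: less_Suc_eq)
      then show ?case using 6(2) r(2) stable by simp
    qed (use vars in auto)
  next
    case (6 r)
    then show ?case by (simp add: entries_def)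
  qed (use vars init stable in auto)
qed

section \<open>Correctness of the colouring program\<close>

abbreviation demand :: "memory \<Rightarrow> nat \<Rightarrow> nat" where
  "demand s v \<equiv> s ''Q'' [v]"

definition available :: "memory \<Rightarrow> nat \<Rightarrow> nat set" where
  "available s v = {c. s ''M'' [v, c] = 1}"

definition chosen :: "memory \<Rightarrow> nat \<Rightarrow> nat set" where
  "chosen s v = (\<lambda>i. s ''C'' [v, i]) ` {..<s ''k'' [] - demand s v}"

lemma wlp_find_active:
  "wlp find_active s (\<lambda>s'. set_in ''A'' s' =
     {v \<in> {..<s ''n'' []}. s ''col'' [] \<in> available s v \<and> 0 < demand s v})"
  unfolding find_active_def
proof (rule wlp_For[where I = "\<lambda>i r. \<forall>w < i. r ''A'' [w] =
    of_bool (s ''col'' [] \<in> available s w \<and> 0 < demand s w)"], goal_cases)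
  case (5 i r)
  then have "r ''M'' = s ''M''" "r ''Q'' = s ''Q''" "r ''col'' = s ''col''" by simp_all
  then show ?case using 5(2,4) by (auto simp: less_Suc_eq available_def)
next
  case (6 r)
  then have "r ''n'' = s ''n''" by simp
  then show ?case using 6(2) by (auto simp: set_in_def of_bool_def split: if_splits)
qed auto

lemma wlp_give_colour:
  assumes le: "\<And>v. v \<in> set_in ''K'' s \<Longrightarrow> 0 < demand s v \<and> demand s v \<le> s ''k'' []"
  shows "wlp give_colour s (\<lambda>s'. \<forall>v < s ''n'' [].
     demand s' v = (if v \<in> set_in ''K'' s then demand s v - 1 else demand s v) \<and>
     available s' v = available s v - {s ''col'' []} \<and>
     chosen s' v = (if v \<in> set_in ''K'' s then insert (s ''col'' []) (chosen s v) else chosen s v))"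
proof -
  let ?K = "set_in ''K'' s"
  show ?thesis
    unfolding give_colour_def
  proof (rule wlp_For[where I = "\<lambda>i r. \<forall>v.
      demand r v = (if v < i \<and> v \<in> ?K then demand s v - 1 else demand s v) \<and>
      (\<forall>c. r ''M'' [v, c] = (if v < i \<and> c = s ''col'' [] then 0 else s ''M'' [v, c])) \<and>
      (\<forall>j. r ''C'' [v, j] = (if v < i \<and> v \<in> ?K \<and> j = s ''k'' [] - demand s v then s ''col'' []
         else s ''C'' [v, j]))"], goal_cases)
    case (5 i r)
    then have r: "r ''k'' = s ''k''" "r ''col'' = s ''col''" "r ''K'' = s ''K''" by simp_all
    have "s ''K'' [i] = 1 \<longleftrightarrow> i \<in> ?K" using 5(1) by (simp add: set_in_def)
    then show ?case using 5(2,4) r by (auto simp: less_Suc_eq)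
  next
    case (6 r)
    have k: "r ''k'' = s ''k''" using 6(1) by simp
    show ?case
    proof (intro allI impI conjI)
      fix v assume v: "v < s ''n'' []"
      show q: "demand r v = (if v \<in> ?K then demand s v - 1 else demand s v)"
        using 6(2) v by simp
      show "available r v = available s v - {s ''col'' []}"
        using 6(2) v by (auto simp: available_def)
      have C: "r ''C'' [v, j] = (if v \<in> ?K \<and> j = s ''k'' [] - demand s v then s ''col'' []
         else s ''C'' [v, j])" for j
        using 6(2) v by simp
      show "chosen r v = (if v \<in> ?K then insert (s ''col'' []) (chosen s v) else chosen s v)"
      proof (cases "v \<in> ?K")
        case True
        \<comment> \<open>Both bounds on the demand matter under truncated subtraction: they make
          the filled part of the row grow by exactly one slot.\<close>
        then have "s ''k'' [] - (demand s v - 1) = Suc (s ''k'' [] - demand s v)"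
          using le[OF True] by linarith
        then show ?thesis
          using True q k C by (auto simp: chosen_def lessThan_Suc)
      next
        case False
        then show ?thesis using q k C by (simp add: chosen_def)
      qed
    qed
  qed auto
qed

abbreviation choice_in :: "memory \<Rightarrow> (nat \<Rightarrow> nat set) \<Rightarrow> bool" where
  "choice_in s S \<equiv> partial_choice (arcs_in s) {..<s ''n'' []} (s ''k'' []) S
     (demand s) (available s) (chosen s)"

lemma wlp_process_colour:
  assumes free: "odd_closed_free (arcs_in s)"
    and S: "\<And>v. v < s ''n'' [] \<Longrightarrow> finite (S v)"
    and pc: "choice_in s S"
  shows "wlp process_colour s (\<lambda>s'. choice_in s' S \<and>
    (\<forall>v < s ''n'' []. available s' v = available s v - {s ''col'' []}))"
  unfolding process_colour_def wlp_Seq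
proof (rule wlp_conseq[OF wlp_find_active], goal_cases)
  case s1: (1 s1)
  have arcs1: "arcs_in s1 = arcs_in s" using s1(2) by (simp add: arcs_in_def)
  have free1: "odd_closed_free (arcs_in s1)" using free arcs1 by simp
  show ?case
  proof (rule wlp_conseq[OF wlp_find_kernel[OF free1]], goal_cases)
    case s2: (1 s2)
    let ?c = "s ''col'' []" and ?K = "set_in ''K'' s2"
    have eqs: "s2 ''n'' = s ''n''" "s2 ''k'' = s ''k''" "s2 ''E'' = s ''E''" "s2 ''M'' = s ''M''"
      "s2 ''Q'' = s ''Q''" "s2 ''C'' = s ''C''" "s2 ''col'' = s ''col''"
      using s1(2) s2(2) by simp_all
    have same: "demand s2 = demand s" "available s2 = available s" "chosen s2 = chosen s"
      using eqs by (auto simp: available_def chosen_def)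
    have K: "kernel (arcs_in s) {v \<in> {..<s ''n'' []}. ?c \<in> available s v \<and> 0 < demand s v} ?K"
      using s2(1) s1(1) arcs1 by simp
    have arcs: "arcs_in s \<subseteq> {..<s ''n'' []} \<times> {..<s ''n'' []}" by (auto simp: arcs_in_def)
    have pc': "partial_choice (arcs_in s) {..<s ''n'' []} (s ''k'' []) S
        (\<lambda>v. if v \<in> ?K then demand s v - 1 else demand s v) (\<lambda>v. available s v - {?c})
        (\<lambda>v. if v \<in> ?K then insert ?c (chosen s v) else chosen s v)"
      by (rule partial_choice_step[OF arcs _ _ pc K]) (use S in auto)
    \<comment> \<open>That the demand is at most \<open>k\<close> follows from the invariant that
      chosen colours and demand add up to \<open>k\<close>.\<close>
    have le: "0 < demand s2 v \<and> demand s2 v \<le> s2 ''k'' []" if "v \<in> ?K" for v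
    proof -
      have "v < s ''n'' []" "0 < demand s v" using that K by (auto simp: kernel_def)
      moreover have "card (chosen s v) + demand s v = s ''k'' []"
        using pc \<open>v < s ''n'' []\<close> by (simp add: partial_choice_def)
      ultimately show ?thesis using eqs by simp
    qed
    show ?case
    proof (rule wlp_conseq[OF wlp_give_colour[OF le]], goal_cases)
      case s3: (2 s3)
      have "s3 ''n'' = s ''n''" "s3 ''k'' = s ''k''" "arcs_in s3 = arcs_in s"
        using s3(2) eqs by (simp_all add: arcs_in_def)
      moreover have "partial_choice (arcs_in s) {..<s ''n'' []} (s ''k'' []) S
          (demand s3) (available s3) (chosen s3)"
        using pc' s3(1) same eqs by (subst partial_choice_cong[OF arcs]) auto
      ultimately show ?case using s3(1) same eqs by simp
    qed
  qed
qed

lemma wlp_choose_colours: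
  assumes M: "\<And>v c. s ''M'' [v, c] = 0"
    and free: "odd_closed_free (arcs_in s)"
    and entries: "entries s = {(v, c). v < s ''n'' [] \<and> c \<in> S v}"
    and S: "\<And>v. v < s ''n'' [] \<Longrightarrow> finite (S v) \<and> card (S v) = s ''k'' [] * (card (arcs_in s `` {v}) + 1)"
  shows "wlp choose_colours s (\<lambda>s'. choice_in s' S \<and> (\<forall>v < s ''n'' []. available s' v = {}))"
  unfolding choose_colours_def wlp_Seq
proof (rule wlp_For[where I = "\<lambda>i r. \<forall>w < i. demand r w = s ''k'' []"], goal_cases)
  case s1: (6 s1)
  let ?n = "s ''n'' []" and ?T = "entries s"
  have eq1: "s1 ''n'' = s ''n''" "s1 ''k'' = s ''k''" "s1 ''E'' = s ''E''" "s1 ''S'' = s ''S''"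
    "s1 ''M'' = s ''M''"
    using s1(1) by simp_all
  have T1: "entries s1 = ?T" using eq1 by (simp add: entries_def row_def row_length_def)
  have "wlp (each_entry mark_colour) s1 (\<lambda>r. \<forall>v c. r ''M'' [v, c] = of_bool ((v, c) \<in> entries s1))"
    by (rule wlp_each_entry[where J = "\<lambda>X r. \<forall>v c. r ''M'' [v, c] = of_bool ((v, c) \<in> X)"])
      (auto simp: mark_colour_def M eq1)
  then show ?case
  proof (rule wlp_conseq, goal_cases)
    case s2: (1 s2)
    have eq2: "s2 ''n'' = s ''n''" "s2 ''k'' = s ''k''" "s2 ''E'' = s ''E''" "s2 ''S'' = s ''S''"
      "s2 ''Q'' = s1 ''Q''"
      using s2(2) eq1 by simp_all
    have T2: "entries s2 = ?T" using eq2 by (simp add: entries_def row_def row_length_def)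
    have arcs2: "arcs_in s2 = arcs_in s" using eq2 by (simp add: arcs_in_def)
    have arcs: "arcs_in s \<subseteq> {..<?n} \<times> {..<?n}" by (auto simp: arcs_in_def)
    have "partial_choice (arcs_in s) {..<?n} (s ''k'' []) S (\<lambda>_. s ''k'' []) S (\<lambda>_. {})"
      by (rule partial_choice_initial) (use arcs S in auto)
    also have "?this \<longleftrightarrow> partial_choice (arcs_in s) {..<?n} (s ''k'' []) S (demand s2) (available s2) (chosen s2)"
      using s1(2) s2(1) T1 entries eq2
      by (intro partial_choice_cong[OF arcs]) (auto simp: available_def chosen_def)
    finally have init: "choice_in s2 S" using eq2 arcs2 by simp
    \<comment> \<open>A visited colour is gone from the lists of all vertices. After all entries
      this empties every list, since what is available always comes from \<open>S\<close>.\<close>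
    let ?J = "\<lambda>X r. r ''n'' = s ''n'' \<and> r ''E'' = s ''E'' \<and> choice_in r S \<and>
        (\<forall>(v, c) \<in> X. \<forall>w < ?n. c \<notin> available r w)"
    have J_store: "?J X (store r x [] i) = ?J X r"
      if "x \<in> {''v'', ''u'', ''i'', ''pos'', ''col''}" for X r x i
    proof -
      have "store r x [] i y = r y"
        if "y \<in> {''n'', ''E'', ''k'', ''Q'', ''M'', ''C''}" for y
        using \<open>x \<in> _\<close> that by auto
      then have eqs: "store r x [] i ''n'' = r ''n''" "store r x [] i ''E'' = r ''E''"
        "store r x [] i ''k'' = r ''k''" "store r x [] i ''Q'' = r ''Q''"
        "store r x [] i ''M'' = r ''M''" "store r x [] i ''C'' = r ''C''"
        by simp_all
      have "available (store r x [] i) = available r" "chosen (store r x [] i) = chosen r"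
        unfolding available_def chosen_def eqs by (rule refl)+
      then show ?thesis by (simp add: arcs_in_def eqs)
    qed
    have "wlp (each_entry process_colour) s2 (?J (entries s2))"
    proof (rule wlp_each_entry[where J = ?J], goal_cases)
      case 2
      show ?case using init eq2 by simp
    next
      case (3 X r x i)
      show ?case by (rule iffD2[OF J_store[OF 3(1)] 3(2)])
    next
      case (4 X r)
      have r: "r ''n'' = s ''n''" "r ''E'' = s ''E''" and choice: "choice_in r S"
        and processed: "\<forall>(v, c) \<in> X. \<forall>w < ?n. c \<notin> available r w"
        using 4(3) by blast+
      have arcs_r: "arcs_in r = arcs_in s" unfolding arcs_in_def r ..
      have "wlp process_colour r (\<lambda>s'. choice_in s' S \<and>
          (\<forall>v < r ''n'' []. available s' v = available r v - {r ''col'' []}))"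
      proof (rule wlp_process_colour)
        show "odd_closed_free (arcs_in r)" using free arcs_r by simp
        show "finite (S v)" if "v < r ''n'' []" for v using S that r by simp
      qed (rule choice)
      then show ?case
      proof (rule wlp_conseq, goal_cases)
        case (1 r')
        have r': "r' ''n'' = s ''n''" "r' ''E'' = s ''E''" using 1(2) r by simp_all
        have "c \<notin> available r' w" if "(v, c) \<in> insert (r ''v'' [], r ''col'' []) X" "w < ?n" for v c w
          using 1(1) processed that r(1) by auto
        then show ?case using r' 1(1) by blast
      qed
    qed auto
    then show ?case
    proof (rule wlp_conseq, goal_cases)
      case (1 r)
      have J: "?J ?T r" using 1(1) unfolding T2 .
      have "available r v = {}" if v: "v < ?n" for v
      proof -
        have "available r v \<subseteq> S v" using J v by (auto simp: partial_choice_def)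
        then show ?thesis using J v unfolding entries by blast
      qed
      then show ?case using J by blast
    qed
  qed
qed (auto simp: less_Suc_eq)

section \<open>The encoded input\<close>

lemma input_simps:
  "input D k L ''n'' [] = card (pverts D)"
  "input D k L ''k'' [] = k"
  "input D k L ''E'' [u, v] = of_bool ((u, v) \<in> parcs D)"
  "input D k L ''S'' [u, j] = (if u \<in> pverts D \<and> j < length (L u) then L u ! j else 0)"
  "input D k L ''M'' [u, j] = 0"
  by (simp_all add: input_def)

context
  fixes D :: "nat pair_pre_digraph" and k :: nat and L :: "nat \<Rightarrow> nat list"
  assumes D: "pair_fin_digraph D" and verts: "pverts D = {..<card (pverts D)}"
    and L: "\<And>v. v \<in> pverts D \<Longrightarrow> distinct (L v) \<and>
      card (set (L v)) = k * (out_degree (with_proj D) v + 1)"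
    and no_odd: "\<not> has_odd_dicycle (with_proj D)"
begin

interpretation pair_fin_digraph D by (rule D)

lemma less_card_pverts: "v < card (pverts D) \<longleftrightarrow> v \<in> pverts D"
  by (subst verts) simp

lemma arcs_in_input: "arcs_in (input D k L) = parcs D"
  by (auto simp: arcs_in_def input_simps less_card_pverts dest: in_arcsD1 in_arcsD2)

lemma row_length_input:
  assumes "v \<in> pverts D"
  shows "row_length (input D k L) v (card (pverts D)) = length (L v)"
proof -
  \<comment> \<open>A loop would be an odd closed walk. Hence \<open>v\<close> is not among its
    out-neighbours, and its own block accounts for the summand 1 in the length of the list.\<close>
  have "(v, v) \<notin> parcs D"
    using odd_closed_free_parcs[OF no_odd] parity_walk_edge
    unfolding odd_closed_free_def by fast
  moreover have "{u. u < card (pverts D) \<and> (u = v \<or> (v, u) \<in> parcs D)} = insert v (parcs D `` {v})"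
    using assms by (auto simp: less_card_pverts dest: in_arcsD2)
  moreover have "finite (parcs D `` {v})" by (rule finite_subset[of _ "pverts D"]) (auto dest: in_arcsD2)
  moreover have "row_length (input D k L) v (card (pverts D)) =
      k * card {u. u < card (pverts D) \<and> (u = v \<or> (v, u) \<in> parcs D)}"
    by (simp only: row_length_def input_simps of_bool_eq_1_iff)
  ultimately have "row_length (input D k L) v (card (pverts D)) = card (set (L v))"
    using L[OF assms] by (simp add: out_degree_eq)
  then show ?thesis using L[OF assms] distinct_card by metis
qed

lemma entries_input:
  "entries (input D k L) = {(v, c). v < card (pverts D) \<and> c \<in> set (L v)}"
proof -
  have "row (input D k L) v (length (L v)) = {v} \<times> set (L v)" if "v \<in> pverts D" for v
    using that by (auto simp: row_def input_simps in_set_conv_nth)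
  then show ?thesis
    unfolding entries_def by (auto simp: input_simps row_length_input less_card_pverts)
qed

lemma choose_colours_correct:
  assumes run: "runs choose_colours (input D k L) t s"
  shows "colour_choice (with_proj D) k (\<lambda>v. set (L v)) (computed_choice k s)"
proof -
  let ?s = "input D k L"
  have "wlp choose_colours ?s (\<lambda>s'. choice_in s' (\<lambda>v. set (L v)) \<and>
      (\<forall>v < ?s ''n'' []. available s' v = {}))"
    by (rule wlp_choose_colours)
      (use L odd_closed_free_parcs[OF no_odd] in
        \<open>auto simp: input_simps arcs_in_input entries_input less_card_pverts out_degree_eq\<close>)
  then have choice: "choice_in s (\<lambda>v. set (L v))" and empty: "\<And>v. v \<in> pverts D \<Longrightarrow> available s v = {}"
    using run by (simp_all add: wlp_def input_simps less_card_pverts)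
  have "s x = ?s x" if "x \<in> {''n'', ''k'', ''E''}" for x
    by (rule runs_unassigned[OF run]) (use that in \<open>auto simp: choose_colours_def\<close>)
  then have "s ''n'' [] = card (pverts D)" and k: "s ''k'' [] = k" and "arcs_in s = parcs D"
    using arcs_in_input by (simp_all add: arcs_in_def input_simps)
  then have pc: "partial_choice (parcs D) (pverts D) k (\<lambda>v. set (L v)) (demand s) (available s) (chosen s)"
    using choice verts by simp
  \<comment> \<open>With no demand left, the filled part of row \<open>v\<close> of \<open>C\<close>
    consists of the first \<open>k\<close> cells, which are the ones that
    \<open>computed_choice\<close> reads.\<close>
  have "demand s v = 0" if "v \<in> pverts D" for v
    using partial_choice_final[OF pc empty that] by blast
  then have "computed_choice k s v = chosen s v" if "v \<in> pverts D" for v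
    using that k by (simp add: computed_choice_def chosen_def)
  then show ?thesis
    using colour_choice_if_partial_choice[OF pc empty] by (simp add: colour_choice_def)
qed

end

theorem theorem4p1:
  shows
   "(\<forall>(D :: 'v pair_pre_digraph) (k :: nat) (S :: 'v \<Rightarrow> 'c set).
       pair_fin_digraph D \<and> 1 \<le> k \<and>
       (\<forall>v \<in> pverts D. finite (S v) \<and> card (S v) = k * (out_degree (with_proj D) v + 1)) \<and>
       \<not> has_odd_dicycle (with_proj D) \<longrightarrow>
       (\<exists>C. colour_choice (with_proj D) k S C))
    \<and>
    (\<exists>(P :: com) (a :: nat) (b :: nat).
       \<forall>(D :: nat pair_pre_digraph) (k :: nat) (L :: nat \<Rightarrow> nat list).
         pair_fin_digraph D \<and> pverts D = {..<card (pverts D)} \<and> 1 \<le> k \<and>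
         (\<forall>v \<in> pverts D. distinct (L v) \<and>
            card (set (L v)) = k * (out_degree (with_proj D) v + 1)) \<and>
         \<not> has_odd_dicycle (with_proj D) \<longrightarrow>
         (\<exists>t s. runs P (input D k L) t s \<and>
            t \<le> a * (card (pverts D) + k) ^ b \<and>
            colour_choice (with_proj D) k (\<lambda>v. set (L v)) (computed_choice k s)))"
proof (rule conjI)
  obtain a b where ab: "\<And>s. 1 \<le> input_size s \<Longrightarrow>
      \<exists>t s'. runs choose_colours s t s' \<and> t \<le> a * input_size s ^ b"
    using polytime_choose_colours by (rule polytimeE) blast
  have size: "input_size (input D k L) = card (pverts D) + k" for D k L
    by (simp add: input_size_def input_simps)
  show "\<exists>(P :: com) (a :: nat) (b :: nat).
       \<forall>(D :: nat pair_pre_digraph) (k :: nat) (L :: nat \<Rightarrow> nat list).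
         pair_fin_digraph D \<and> pverts D = {..<card (pverts D)} \<and> 1 \<le> k \<and>
         (\<forall>v \<in> pverts D. distinct (L v) \<and>
            card (set (L v)) = k * (out_degree (with_proj D) v + 1)) \<and>
         \<not> has_odd_dicycle (with_proj D) \<longrightarrow>
         (\<exists>t s. runs P (input D k L) t s \<and>
            t \<le> a * (card (pverts D) + k) ^ b \<and>
            colour_choice (with_proj D) k (\<lambda>v. set (L v)) (computed_choice k s))"
  proof (rule exI[of _ choose_colours], rule exI[of _ a], rule exI[of _ b], intro allI impI, elim conjE)
    fix D :: "nat pair_pre_digraph" and k :: nat and L :: "nat \<Rightarrow> nat list"
    assume D: "pair_fin_digraph D" "pverts D = {..<card (pverts D)}" "1 \<le> k"
      "\<forall>v \<in> pverts D. distinct (L v) \<and> card (set (L v)) = k * (out_degree (with_proj D) v + 1)"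
      "\<not> has_odd_dicycle (with_proj D)"
    \<comment> \<open>As \<open>k\<close> is positive, the input size is at least 1, and the time
      bound applies.\<close>
    obtain t s where "runs choose_colours (input D k L) t s" "t \<le> a * (card (pverts D) + k) ^ b"
      using ab[of "input D k L"] D(3) unfolding size by auto
    then show "\<exists>t s. runs choose_colours (input D k L) t s \<and> t \<le> a * (card (pverts D) + k) ^ b \<and>
        colour_choice (with_proj D) k (\<lambda>v. set (L v)) (computed_choice k s)"
      using choose_colours_correct[OF D(1,2) _ D(5)] D(4) by blast
  qed
qed (auto intro: pair_fin_digraph.colour_choice_exists)

end
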